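(* Let $(V,H,V')$ be a normal triple of Hilbert spaces and let $\mathbf A:V\to V'$ be a bounded linear operator such that for every $F\in V'$ there exists a unique $U=\mathbf A^{-1}F\in V$ with $\mathbf AU=F$, and $\|U\|_V\le C_A\|F\|_{V'}$. Let each $\mathbf M_k$, $k\ge1$, be a bounded linear operator from $V$ to $V'$ with $\|\mathbf A^{-1}\mathbf M_kv\|_V\le C_k\|v\|_V$ for all $v\in V$, $C_k$ independent of $v$. Let $f\in V'$ be non-random and let $u=\sum_\alpha u_\alpha\xi_\alpha$ be the solution of $$\mathbf Au+\sum_{k\ge1}(\mathbf M_ku)\diamond\xi_k=f.$$ Put $\mathbf B_k=-\mathbf A^{-1}\mathbf M_k$ and $u_{(0)}=\mathbf A^{-1}f$. Then: (1) For $\alpha$ with $|\alpha|=n\ge1$ and characteristic set $K_\alpha=\{k_1,\dots,k_n\}$, $$u_\alpha=\frac1{\sqrt{\alpha!}}\sum_{\sigma\in\mathcal P_n}\mathbf B_{k_{\sigma(n)}}\cdots\mathbf B_{k_{\sigma(1)}}u_{(0)},$$ where $\mathcal P_n$ is the permutation group of $(1,\dots,n)$. (2) $u\in\mathcal RL_2(\mathbb F;V)$ with the weights $$r_\alpha=\frac{q^\alpha}{\sqrt{|\alpha|!}},\qquad q^\alpha=\prod_{k\ge1}q_k^{\alpha_k},$$ where the positive numbers $q_k$ are chosen so that $\sum_{k\ge1}q_k^2C_k^2<1$. (3) With such $r_\alpha$ and $q_k$, and $\overline{\mathbf B}=-(q_1\mathbf A^{-1}\mathbf M_1,q_2\mathbf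 A^{-1}\mathbf M_2,\dots)$, for every $n\ge1$ $$\sum_{|\alpha|=n}q^\alpha u_\alpha\xi_\alpha=\delta^{(n)}_{\overline{\mathbf B}}(\mathbf A^{-1}f),$$ and $$\mathcal Ru=\mathbf A^{-1}f+\sum_{n\ge1}\frac1{\sqrt{n!}}\,\delta^{(n)}_{\overline{\mathbf B}}(\mathbf A^{-1}f).$$
   Context: Wiener chaos. $\mathbb F=(\Omega,\mathcal F,\mathbb P)$ is a complete probability space, $\mathcal U$ a real separable Hilbert space with orthonormal basis $\{\mathfrak u_k\}_{k\ge1}$, $\dot W=\{\dot W(h),h\in\mathcal U\}$ a zero-mean Gaussian family with $\mathbb E(\dot W(h_1)\dot W(h_2))=(h_1,h_2)_{\mathcal U}$, and $\mathcal F$ is generated by $\dot W$. Put $\xi_k=\dot W(\mathfrak u_k)$. $\mathcal J$ is the set of multi-indices $\alpha=(\alpha_1,\alpha_2,\dots)$ of non-negative integers with $|\alpha|=\sum_k\alpha_k<\infty$; $\alpha!=\prod_k\alpha_k!$; $(0)$ is the zero multi-index; $\varepsilon_k$ has $1$ in position $k$ and $0$ elsewhere. $\xi_\alpha=\prod_k H_{\alpha_k}(\xi_k)/\sqrt{\alpha_k!}$, $H_n(x)=(-1)^ne^{x^2/2}\frac{d^n}{dx^n}e^{-x^2/2}$. The characteristic set $K_\alpha$ of $\alpha$ with $|\alpha|=n\ge1$ is the ordered $n$-tuple $k_1\le\dots\le k_n$ in which each index $k$ is repeated $\alpha_k$ times. Weighted spaces. For positive weights $\{r_\alpha\}_{\alpha\in\mathcal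 J}$ and a Hilbert space $X$, $\mathcal R L_2(\mathbb F;X)$ is the space of formal series $v=\sum_{\alpha}v_\alpha\xi_\alpha$, $v_\alpha\in X$, with $\sum_\alpha r_\alpha^2\|v_\alpha\|_X^2<\infty$, and $\mathcal Rv=\sum_\alpha r_\alpha v_\alpha\xi_\alpha$. Normal triple: dense continuous embeddings $V\hookrightarrow H\hookrightarrow V'$, $V'$ is the dual of $V$ relative to the inner product of $H$, and $|(h,v)_H|\le C\|v\|_V\|h\|_{V'}$ for $v\in V,h\in H$. The operators $\delta^{(n)}$: for $\mathbf B=(\mathbf B_1,\mathbf B_2,\dots)$ with $\mathbf B_k:V\to V$ (so $\mathbf Bv=\sum_k(\mathbf B_kv)\otimes\mathfrak u_k$) and a formal series $\eta=\sum_\alpha\eta_\alpha\xi_\alpha$ with coefficients in $V$, $\delta(\mathbf B\eta)=\sum_k(\mathbf B_k\eta)\diamond\xi_k$ is the formal series with $\alpha$-th coefficient $\sum_k\sqrt{\alpha_k}\,\mathbf B_k\eta_{\alpha-\varepsilon_k}$ (terms with $\alpha_k=0$ are zero). Then $\delta^{(0)}_{\mathbf B}(\eta)=\eta$, $\delta^{(n)}_{\mathbf B}(\eta)=\delta(\mathbf B\,\delta^{(n-1)}_{\mathbf B}(\eta))$. Solution: $u=\sum_\alpha u_\alpha\xi_\alpha$, $u_\alpha\in V$, such that for every $\alpha\in\mathcal J$, $\mathbf Au_\alpha+\sum_{k\ge1}\sqrt{\alpha_k}\,\mathbf M_ku_{\alpha-\varepsilon_k}=f\,I_{(\alpha=(0))}$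 in $V'$; this system determines $u$ uniquely. *)

theory Defs
  imports
    "HOL-Probability.Probability"
    "HOL-Combinatorics.Permutations"
    "HOL-Library.Poly_Mapping"
begin

section \<open>Multi-indices\<close>

text \<open>Positions are numbered from \<open>0\<close> instead of \<open>1\<close>, both in multi-indices and in
  characteristic sets.\<close>

type_synonym multi_index = "nat \<Rightarrow>\<^sub>0 nat"

abbreviation mi_unit :: "nat \<Rightarrow> multi_index" where
  "mi_unit k \<equiv> Poly_Mapping.single k 1"

definition mi_deg :: "multi_index \<Rightarrow> nat" where
  "mi_deg \<alpha> = (\<Sum>k\<in>Poly_Mapping.keys \<alpha>. Poly_Mapping.lookup \<alpha> k)"

definition mi_fact :: "multi_index \<Rightarrow> nat" where
  "mi_fact \<alpha> = (\<Prod>k\<in>Poly_Mapping.keys \<alpha>. fact (Poly_Mapping.lookup \<alpha> k))"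

definition mi_power :: "(nat \<Rightarrow> real) \<Rightarrow> multi_index \<Rightarrow> real" where
  "mi_power q \<alpha> = (\<Prod>k\<in>Poly_Mapping.keys \<alpha>. q k ^ Poly_Mapping.lookup \<alpha> k)"

definition characteristic_set :: "multi_index \<Rightarrow> nat list" where
  "characteristic_set \<alpha> =
    concat (map (\<lambda>k. replicate (Poly_Mapping.lookup \<alpha> k) k)
      (sorted_list_of_set (Poly_Mapping.keys \<alpha>)))"


section \<open>Wiener chaos\<close>

text \<open>The point mass at \<open>0\<close> counts as a centred Gaussian law.\<close>

definition centered_gaussian :: "'a measure \<Rightarrow> ('a \<Rightarrow> real) \<Rightarrow> bool" where
  "centered_gaussian P X \<longleftrightarrow>
    X \<in> borel_measurable P \<and>
    ((AE \<omega> in P. X \<omega> = 0) \<or>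
     (\<exists>\<sigma>>0. distributed P lborel X (\<lambda>x. ennreal (normal_density 0 \<sigma> x))))"

definition centered_gaussian_family :: "'a measure \<Rightarrow> ('i \<Rightarrow> 'a \<Rightarrow> real) \<Rightarrow> bool" where
  "centered_gaussian_family P W \<longleftrightarrow>
    (\<forall>S c. finite S \<longrightarrow> centered_gaussian P (\<lambda>\<omega>. \<Sum>h\<in>S. c h * W h \<omega>))"

text \<open>As usual for a complete space, ``generated by the noise'' is understood up to null sets; the
  \<open>\<sigma>\<close>-algebra assumption also holds if the events are exactly the sets generated by the noise.\<close>

locale wiener_chaos = prob_space P + complete_measure P
  for P :: "'a measure" +
  fixes W :: "'u :: {real_inner, complete_space, second_countable_topology} \<Rightarrow> 'a \<Rightarrow> real"
    and e :: "nat \<Rightarrow> 'u"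
  assumes basis_orthonormal: "e j \<bullet> e k = (if j = k then 1 else 0)"
    and basis_total: "closure (span (range e)) = UNIV"
    and noise_gaussian: "centered_gaussian_family P W"
    and noise_covariance: "expectation (\<lambda>\<omega>. W h1 \<omega> * W h2 \<omega>) = h1 \<bullet> h2"
    and events_generated:
      "sets P = sigma_sets (space P)
        ({W h -` S \<inter> space P | h S. S \<in> sets borel} \<union> null_sets P)"

definition hermite :: "nat \<Rightarrow> real \<Rightarrow> real" where
  "hermite n x = (-1) ^ n * exp (x\<^sup>2 / 2) * (deriv ^^ n) (\<lambda>y. exp (- (y\<^sup>2) / 2)) x"

definition chaos_basis ::
    "('u \<Rightarrow> 'a \<Rightarrow> real) \<Rightarrow> (nat \<Rightarrow> 'u) \<Rightarrow> multi_index \<Rightarrow> 'a \<Rightarrow> real" where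
  "chaos_basis W e \<alpha> \<omega> =
    (\<Prod>k\<in>Poly_Mapping.keys \<alpha>.
      hermite (Poly_Mapping.lookup \<alpha> k) (W (e k) \<omega>) / sqrt (fact (Poly_Mapping.lookup \<alpha> k)))"


section \<open>Formal chaos series and weighted spaces\<close>

text \<open>A formal series \<open>\<Sum>\<alpha>. v\<^sub>\<alpha> \<xi>\<^sub>\<alpha>\<close> is the family of its coefficients.\<close>

type_synonym 'x chaos_series = "multi_index \<Rightarrow> 'x"

definition nonrandom :: "'x :: zero \<Rightarrow> 'x chaos_series" where
  "nonrandom x = (\<lambda>\<alpha>. if \<alpha> = 0 then x else 0)"

definition weighted_L2 :: "(multi_index \<Rightarrow> real) \<Rightarrow> 'x :: real_normed_vector chaos_series set" where
  "weighted_L2 r = {v. (\<lambda>\<alpha>. (r \<alpha>)\<^sup>2 * (norm (v \<alpha>))\<^sup>2) summable_on UNIV}"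

definition weight_op ::
    "(multi_index \<Rightarrow> real) \<Rightarrow> 'x :: real_vector chaos_series \<Rightarrow> 'x chaos_series" where
  "weight_op r v = (\<lambda>\<alpha>. r \<alpha> *\<^sub>R v \<alpha>)"

definition L2_tendsto ::
    "'a measure \<Rightarrow> ('i \<Rightarrow> 'a \<Rightarrow> 'x :: real_normed_vector) \<Rightarrow> ('a \<Rightarrow> 'x) \<Rightarrow> 'i filter \<Rightarrow> bool" where
  "L2_tendsto P Z X F \<longleftrightarrow>
    ((\<lambda>i. \<integral>\<^sup>+ \<omega>. ennreal ((norm (Z i \<omega> - X \<omega>))\<^sup>2) \<partial>P) \<longlongrightarrow> 0) F"

text \<open>The random element \<open>X\<close> is the sum in \<open>L\<^sub>2\<close> of the series with coefficients \<open>v\<close>.\<close>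

definition has_chaos_expansion ::
    "'a measure \<Rightarrow> ('u \<Rightarrow> 'a \<Rightarrow> real) \<Rightarrow> (nat \<Rightarrow> 'u) \<Rightarrow>
      ('a \<Rightarrow> 'x :: real_normed_vector) \<Rightarrow> 'x chaos_series \<Rightarrow> bool" where
  "has_chaos_expansion P W e X v \<longleftrightarrow>
    X \<in> borel_measurable P \<and>
    L2_tendsto P (\<lambda>S \<omega>. \<Sum>\<alpha>\<in>S. chaos_basis W e \<alpha> \<omega> *\<^sub>R v \<alpha>) X (finite_subsets_at_top UNIV)"


section \<open>The operators \<open>\<delta>\<close> and the stochastic equation\<close>

text \<open>\<open>skorohod B \<eta>\<close> is \<open>\<delta>(B\<eta>)\<close>, the sum over \<open>k\<close> of the Wick products of \<open>B\<^sub>k \<eta>\<close> and \<open>\<xi>\<^sub>k\<close>.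
  Indices outside \<open>keys \<alpha>\<close> contribute \<open>0\<close>.\<close>

definition skorohod ::
    "(nat \<Rightarrow> 'x \<Rightarrow> 'y :: real_vector) \<Rightarrow> 'x chaos_series \<Rightarrow> 'y chaos_series" where
  "skorohod B \<eta> =
    (\<lambda>\<alpha>. \<Sum>k\<in>Poly_Mapping.keys \<alpha>.
      sqrt (real (Poly_Mapping.lookup \<alpha> k)) *\<^sub>R B k (\<eta> (\<alpha> - mi_unit k)))"

primrec skorohod_iter ::
    "(nat \<Rightarrow> 'x \<Rightarrow> 'x :: real_vector) \<Rightarrow> nat \<Rightarrow> 'x chaos_series \<Rightarrow> 'x chaos_series" where
  "skorohod_iter B 0 \<eta> = \<eta>"
| "skorohod_iter B (Suc n) \<eta> = skorohod B (skorohod_iter B n \<eta>)"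

definition chaos_solution ::
    "('v \<Rightarrow> 'w :: real_vector) \<Rightarrow> (nat \<Rightarrow> 'v \<Rightarrow> 'w) \<Rightarrow> 'w \<Rightarrow> 'v chaos_series \<Rightarrow> bool" where
  "chaos_solution A M f u \<longleftrightarrow> (\<forall>\<alpha>. A (u \<alpha>) + skorohod M u \<alpha> = nonrandom f \<alpha>)"

text \<open>The embeddings are explicit maps \<open>i : V \<rightarrow> H\<close> and \<open>j : H \<rightarrow> V'\<close>; \<open>D\<close> identifies \<open>V'\<close> with the
  space of continuous functionals on \<open>V\<close>, extending the inner product of \<open>H\<close>.\<close>

definition normal_triple ::
    "('v :: {real_inner, complete_space} \<Rightarrow> 'h :: {real_inner, complete_space}) \<Rightarrow>
      ('h \<Rightarrow> 'w :: {real_inner, complete_space}) \<Rightarrow> bool" where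
  "normal_triple i j \<longleftrightarrow>
    bounded_linear i \<and> inj i \<and> closure (range i) = UNIV \<and>
    bounded_linear j \<and> inj j \<and> closure (range j) = UNIV \<and>
    (\<exists>D :: 'w \<Rightarrow> 'v \<Rightarrow>\<^sub>L real. bounded_linear D \<and> bij D \<and>
      (\<forall>h v. blinfun_apply (D (j h)) v = h \<bullet> i v)) \<and>
    (\<exists>C. \<forall>h v. \<bar>h \<bullet> i v\<bar> \<le> C * norm v * norm (j h))"

end

theory Submission
  imports Defs "HOL-Computational_Algebra.Formal_Power_Series"
begin

text \<open>
  Applying \<open>A\<^sup>-\<^sup>1\<close> to the equation for the coefficients gives \<open>u\<^sub>\<alpha> = \<Sum>k. \<surd>\<alpha>\<^sub>k B\<^sub>k u\<^bsub>\<alpha> - \<epsilon>\<^sub>k\<^esub>\<close> for \<open>\<alpha> \<noteq> 0\<close>.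
  Splitting the permutations of the characteristic set according to the value at the last position
  yields the same recursion for \<open>\<surd>\<alpha>! u\<^sub>\<alpha>\<close>. The coefficients \<open>w\<^sub>\<alpha> = q\<^sup>\<alpha> u\<^sub>\<alpha>\<close> obey the recursion with
  \<open>q\<^sub>k B\<^sub>k\<close> in place of \<open>B\<^sub>k\<close>, so the level \<open>|\<alpha>| = n\<close> of \<open>w\<close> is the \<open>n\<close>-th iterate of \<open>\<delta>\<close>. By
  Cauchy-Schwarz and \<open>\<Sum>k. \<alpha>\<^sub>k = |\<alpha>|\<close>, the numbers \<open>y\<^sub>\<alpha> = \<parallel>w\<^sub>\<alpha>\<parallel>\<^sup>2 / |\<alpha>|!\<close> satisfy
  \<open>y\<^sub>\<alpha> \<le> \<Sum>k. q\<^sub>k\<^sup>2 C\<^sub>k\<^sup>2 y\<^bsub>\<alpha> - \<epsilon>\<^sub>k\<^esub>\<close>, whence their sum over the level \<open>n\<close> is at most \<open>(\<Sum>k. q\<^sub>k\<^sup>2 C\<^sub>k\<^sup>2)\<^sup>n y\<^sub>0\<close>.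

  The chaos basis is orthonormal because the mixed moments of the \<open>\<xi>\<^sub>k\<close> are determined by the moments
  of their linear combinations, which are Gaussian; Gaussian integration by parts then gives the
  orthogonality of the Hermite polynomials. Along finite index sets whose tails decrease
  geometrically the partial sums of a square-summable chaos series converge almost surely, and
  Fatou's lemma bounds the remainder in \<open>L\<^sub>2\<close>.
\<close>

subsection \<open>Multi-indices\<close>

lemma prod_keys_superset:
  fixes g :: "'k \<Rightarrow> 'n :: zero \<Rightarrow> 'b :: comm_monoid_mult"
  assumes "finite T" "Poly_Mapping.keys \<alpha> \<subseteq> T" "\<And>k. g k 0 = 1"
  shows "(\<Prod>k\<in>Poly_Mapping.keys \<alpha>. g k (Poly_Mapping.lookup \<alpha> k))
    = (\<Prod>k\<in>T. g k (Poly_Mapping.lookup \<alpha> k))"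
  using assms by (intro prod.mono_neutral_left) (auto simp: in_keys_iff)

lemma lookup_diff_single:
  "Poly_Mapping.lookup (\<alpha> - Poly_Mapping.single k m) l
    = (if l = k then Poly_Mapping.lookup \<alpha> l - m else Poly_Mapping.lookup \<alpha> l)"
  by (simp add: lookup_minus lookup_single when_def)

lemma diff_add_mi_unit: "k \<in> Poly_Mapping.keys \<alpha> \<Longrightarrow> \<alpha> - mi_unit k + mi_unit k = \<alpha>"
  by (rule poly_mapping_eqI) (auto simp: lookup_add lookup_minus lookup_single in_keys_iff when_def)

lemma prod_keys_diff_mi_unit:
  fixes g :: "nat \<Rightarrow> nat \<Rightarrow> 'b :: comm_monoid_mult"
  assumes k: "k \<in> Poly_Mapping.keys \<alpha>" and g_0: "\<And>l. g l 0 = 1"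
    and g_k: "g k (Poly_Mapping.lookup \<alpha> k) = c * g k (Poly_Mapping.lookup \<alpha> k - 1)"
  shows "(\<Prod>l\<in>Poly_Mapping.keys \<alpha>. g l (Poly_Mapping.lookup \<alpha> l))
    = c * (\<Prod>l\<in>Poly_Mapping.keys (\<alpha> - mi_unit k). g l (Poly_Mapping.lookup (\<alpha> - mi_unit k) l))"
proof -
  let ?K = "Poly_Mapping.keys \<alpha>"
  have "Poly_Mapping.keys (\<alpha> - mi_unit k) \<subseteq> ?K"
    by (auto simp: in_keys_iff lookup_diff_single split: if_splits)
  then have "(\<Prod>l\<in>Poly_Mapping.keys (\<alpha> - mi_unit k). g l (Poly_Mapping.lookup (\<alpha> - mi_unit k) l))
      = (\<Prod>l\<in>?K. g l (Poly_Mapping.lookup (\<alpha> - mi_unit k) l))"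
    by (intro prod_keys_superset g_0) auto
  also have "\<dots> = g k (Poly_Mapping.lookup \<alpha> k - 1) * (\<Prod>l\<in>?K - {k}. g l (Poly_Mapping.lookup \<alpha> l))"
    using k by (simp add: prod.remove[of ?K k] lookup_diff_single)
  finally show ?thesis
    using k by (simp add: prod.remove[of ?K k] g_k mult.assoc)
qed

lemma mi_deg_add: "mi_deg (\<alpha> + \<beta>) = mi_deg \<alpha> + mi_deg \<beta>"
  unfolding mi_deg_def by (rule setsum_keys_plus_distrib) auto

lemma mi_deg_diff_mi_unit:
  assumes "k \<in> Poly_Mapping.keys \<alpha>"
  shows "mi_deg \<alpha> = Suc (mi_deg (\<alpha> - mi_unit k))"
  using mi_deg_add[of "\<alpha> - mi_unit k" "mi_unit k"] diff_add_mi_unit[OF assms] by (simp add: mi_deg_def)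

lemma mi_fact_diff_mi_unit:
  assumes "k \<in> Poly_Mapping.keys \<alpha>"
  shows "mi_fact \<alpha> = Poly_Mapping.lookup \<alpha> k * mi_fact (\<alpha> - mi_unit k)"
  unfolding mi_fact_def using assms
  by (intro prod_keys_diff_mi_unit) (auto simp: in_keys_iff fact_reduce)

lemma mi_power_diff_mi_unit:
  assumes "k \<in> Poly_Mapping.keys \<alpha>"
  shows "mi_power q \<alpha> = q k * mi_power q (\<alpha> - mi_unit k)"
  unfolding mi_power_def using assms
  by (intro prod_keys_diff_mi_unit) (auto simp: in_keys_iff power_eq_if)

lemma mi_deg_eq_0_iff: "mi_deg \<alpha> = 0 \<longleftrightarrow> \<alpha> = 0"
  by (auto simp: mi_deg_def in_keys_iff intro!: poly_mapping_eqI)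

lemma mi_zero_simps [simp]: "mi_deg 0 = 0" "mi_fact 0 = 1" "mi_power q 0 = 1"
  by (simp_all add: mi_deg_def mi_fact_def mi_power_def)

lemma mi_fact_pos: "mi_fact \<alpha> > 0"
  by (simp add: mi_fact_def prod_pos)

subsection \<open>Enumerations of a multi-index\<close>

definition enumerates :: "(nat \<Rightarrow> nat) \<Rightarrow> nat \<Rightarrow> multi_index \<Rightarrow> bool" where
  "enumerates x n \<alpha> \<longleftrightarrow> (\<forall>k. count (mset (map x [0..<n])) k = Poly_Mapping.lookup \<alpha> k)"

lemma enumerates_characteristic_set: "enumerates ((!) (characteristic_set \<alpha>)) (mi_deg \<alpha>) \<alpha>"
proof -
  have "length (characteristic_set \<alpha>) = mi_deg \<alpha>"
    by (simp add: characteristic_set_def mi_deg_def length_concat comp_def sum_list_distinct_conv_sum_set)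
  moreover have "count (mset (characteristic_set \<alpha>)) k = Poly_Mapping.lookup \<alpha> k" for k
  proof -
    have "count (mset (concat (map (\<lambda>k. replicate (m k) k) ks))) k = (if k \<in> set ks then m k else 0)"
      if "distinct ks" for ks :: "nat list" and m :: "nat \<Rightarrow> nat"
      using that by (induction ks) auto
    from this[of "sorted_list_of_set (Poly_Mapping.keys \<alpha>)" "Poly_Mapping.lookup \<alpha>"] show ?thesis
      by (auto simp: characteristic_set_def in_keys_iff)
  qed
  ultimately show ?thesis
    unfolding enumerates_def by (metis map_nth)
qed

lemma enumerates_0: "enumerates x 0 \<alpha> \<Longrightarrow> \<alpha> = 0"
  by (auto simp: enumerates_def intro: poly_mapping_eqI)

lemma enumerates_image: "enumerates x n \<alpha> \<Longrightarrow> x ` {..<n} = Poly_Mapping.keys \<alpha>"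
proof -
  assume "enumerates x n \<alpha>"
  then have "k \<in> set (map x [0..<n]) \<longleftrightarrow> k \<in> Poly_Mapping.keys \<alpha>" for k
    unfolding enumerates_def by (metis count_mset_0_iff in_keys_iff)
  then show ?thesis
    by (auto simp: atLeast0LessThan)
qed

lemma enumerates_card:
  assumes "enumerates x n \<alpha>"
  shows "card {b. b < n \<and> x b = k} = Poly_Mapping.lookup \<alpha> k"
proof -
  have "{b. b < n \<and> x b = k} = {b. b < length (map x [0..<n]) \<and> k = map x [0..<n] ! b}"
    by auto
  also have "card \<dots> = count (mset (map x [0..<n])) k"
    by (simp only: count_mset count_list_eq_length_filter length_filter_conv_card)
  finally show ?thesis
    using assms by (simp add: enumerates_def)
qed

text \<open>Entry \<open>b\<close> is removed by overwriting it with the last one.\<close>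

lemma enumerates_transpose:
  assumes enumerates_x: "enumerates x (Suc n) \<alpha>" and b: "b < Suc n"
  shows "enumerates (x \<circ> Transposition.transpose n b) n (\<alpha> - mi_unit (x b))"
  unfolding enumerates_def
proof
  fix k
  have "Transposition.transpose n b permutes {..<length (map x [0..<Suc n])}"
    using b by (intro permutes_swap_id) auto
  then have "mset (map x [0..<Suc n]) = mset (permute_list (Transposition.transpose n b) (map x [0..<Suc n]))"
    by (rule mset_permute_list[symmetric])
  also have "permute_list (Transposition.transpose n b) (map x [0..<Suc n])
      = map (x \<circ> Transposition.transpose n b) [0..<Suc n]"
    using b by (auto simp: permute_list_def Transposition.transpose_def simp del: upt_Suc)
  finally show "count (mset (map (x \<circ> Transposition.transpose n b) [0..<n])) k
      = Poly_Mapping.lookup (\<alpha> - mi_unit (x b)) k"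
    using enumerates_x[unfolded enumerates_def, rule_format, of k] by (auto simp: lookup_diff_single)
qed

lemma sum_enumerates:
  fixes g :: "nat \<Rightarrow> 'v :: real_vector"
  assumes "enumerates x n \<alpha>"
  shows "(\<Sum>b<n. g (x b)) = (\<Sum>k\<in>Poly_Mapping.keys \<alpha>. real (Poly_Mapping.lookup \<alpha> k) *\<^sub>R g k)"
proof -
  have "(\<Sum>b<n. g (x b)) = (\<Sum>k\<in>x ` {..<n}. \<Sum>b\<in>{b \<in> {..<n}. x b = k}. g (x b))"
    by (rule sum.image_gen) simp
  also have "\<dots> = (\<Sum>k\<in>Poly_Mapping.keys \<alpha>. real (Poly_Mapping.lookup \<alpha> k) *\<^sub>R g k)"
    unfolding enumerates_image[OF assms]
    by (intro sum.cong) (auto simp: sum_constant_scaleR enumerates_card[OF assms])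
  finally show ?thesis .
qed

subsection \<open>The propagator\<close>

definition propagator :: "(nat \<Rightarrow> 'v \<Rightarrow> 'v :: real_vector) \<Rightarrow> 'v chaos_series \<Rightarrow> bool" where
  "propagator B u \<longleftrightarrow> (\<forall>\<alpha>. \<alpha> \<noteq> 0 \<longrightarrow> u \<alpha> = skorohod B u \<alpha>)"

lemma propagatorD: "propagator B u \<Longrightarrow> \<alpha> \<noteq> 0 \<Longrightarrow> u \<alpha> = skorohod B u \<alpha>"
  by (simp add: propagator_def)

lemma bij_linear_imp_linear_inv:
  fixes A :: "'v :: real_vector \<Rightarrow> 'w :: real_vector"
  assumes "linear A" "bij A"
  shows "linear (inv A)"
proof -
  interpret A: Vector_Spaces.linear scaleR scaleR A
    using assms(1) by (simp add: linear_def)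
  have "A (inv A y) = y" "inv A (A x) = x" for x y
    using assms(2) by (simp_all add: bij_is_surj surj_f_inv_f bij_is_inj)
  then show ?thesis
    by (intro linearI) (metis A.add, metis A.scale)
qed

lemma linear_neg_inv_compose:
  fixes A :: "'v :: real_vector \<Rightarrow> 'w :: real_vector" and M :: "'v \<Rightarrow> 'w"
  assumes "linear A" "bij A" "linear M"
  shows "linear (\<lambda>v. - inv A (M v))"
  using linear_compose[OF assms(3) bij_linear_imp_linear_inv[OF assms(1,2)]]
  by (auto simp: comp_def intro: linear_compose_neg)

lemma chaos_solution_imp_propagator:
  fixes A :: "'v :: real_vector \<Rightarrow> 'w :: real_vector"
  assumes A: "linear A" "bij A" and solution: "chaos_solution A M f u"
  shows "u 0 = inv A f" "propagator (\<lambda>k v. - inv A (M k v)) u"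
proof -
  note linear_inv = bij_linear_imp_linear_inv[OF A]
  have u_eq: "u \<alpha> = inv A (nonrandom f \<alpha>) - inv A (skorohod M u \<alpha>)" for \<alpha>
  proof -
    have "A (u \<alpha>) = nonrandom f \<alpha> - skorohod M u \<alpha>"
      using solution by (simp add: chaos_solution_def eq_diff_eq)
    then show ?thesis
      by (metis A(2) bij_is_inj inv_f_f linear_diff[OF linear_inv])
  qed
  show "u 0 = inv A f"
    using u_eq[of 0] by (simp add: nonrandom_def skorohod_def linear_0[OF linear_inv])
  show "propagator (\<lambda>k v. - inv A (M k v)) u"
    unfolding propagator_def
  proof (intro allI impI)
    fix \<alpha> :: multi_index assume "\<alpha> \<noteq> 0"
    then show "u \<alpha> = skorohod (\<lambda>k v. - inv A (M k v)) u \<alpha>"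
      using u_eq[of \<alpha>]
      by (simp add: nonrandom_def skorohod_def linear_0[OF linear_inv]
          linear_sum[OF linear_inv] linear_scale[OF linear_inv] sum_negf)
  qed
qed

lemma propagator_weight_op:
  assumes linear_B: "\<And>k. linear (B k)" and propagator_u: "propagator B u"
  shows "propagator (\<lambda>k v. q k *\<^sub>R B k v) (weight_op (mi_power q) u)"
  unfolding propagator_def
proof (intro allI impI)
  fix \<alpha> :: multi_index assume "\<alpha> \<noteq> 0"
  then have "weight_op (mi_power q) u \<alpha> = mi_power q \<alpha> *\<^sub>R skorohod B u \<alpha>"
    by (simp add: weight_op_def flip: propagatorD[OF propagator_u])
  also have "\<dots> = skorohod (\<lambda>k v. q k *\<^sub>R B k v) (weight_op (mi_power q) u) \<alpha>"
    unfolding skorohod_def scaleR_sum_right weight_op_def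
    by (intro sum.cong refl) (simp add: linear_scale[OF linear_B] mi_power_diff_mi_unit mult_ac)
  finally show "weight_op (mi_power q) u \<alpha> = skorohod (\<lambda>k v. q k *\<^sub>R B k v) (weight_op (mi_power q) u) \<alpha>" .
qed

definition chaos_weight :: "(nat \<Rightarrow> real) \<Rightarrow> multi_index \<Rightarrow> real" where
  "chaos_weight q \<alpha> = mi_power q \<alpha> / sqrt (fact (mi_deg \<alpha>))"

lemma weight_op_chaos_weight:
  "weight_op (chaos_weight q) u = weight_op (\<lambda>\<alpha>. 1 / sqrt (fact (mi_deg \<alpha>))) (weight_op (mi_power q) u)"
  by (simp add: weight_op_def chaos_weight_def)

subsection \<open>Symmetrized products of operators\<close>

definition symmetrized_fold ::
    "(nat \<Rightarrow> 'v \<Rightarrow> 'v :: real_vector) \<Rightarrow> (nat \<Rightarrow> nat) \<Rightarrow> nat \<Rightarrow> 'v \<Rightarrow> 'v" where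
  "symmetrized_fold B x n v = (\<Sum>\<sigma> | \<sigma> permutes {..<n}. fold (\<lambda>l. B (x (\<sigma> l))) [0..<n] v)"

lemma symmetrized_fold_0 [simp]: "symmetrized_fold B x 0 v = v"
  by (simp add: symmetrized_fold_def)

lemma symmetrized_fold_Suc:
  assumes linear_B: "\<And>k. linear (B k)"
  shows "symmetrized_fold B x (Suc n) v
    = (\<Sum>b<Suc n. B (x b) (symmetrized_fold B (x \<circ> Transposition.transpose n b) n v))"
proof -
  have "symmetrized_fold B x (Suc n) v = (\<Sum>b<Suc n. \<Sum>\<sigma> | \<sigma> permutes {..<n}.
      fold (\<lambda>l. B (x ((Transposition.transpose n b \<circ> \<sigma>) l))) [0..<Suc n] v)"
    unfolding symmetrized_fold_def lessThan_Suc by (rule sum_over_permutations_insert) auto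
  also have "\<dots> = (\<Sum>b<Suc n. \<Sum>\<sigma> | \<sigma> permutes {..<n}.
      B (x b) (fold (\<lambda>l. B ((x \<circ> Transposition.transpose n b) (\<sigma> l))) [0..<n] v))"
    by (intro sum.cong refl) (simp add: permutes_not_in comp_def)
  also have "\<dots> = (\<Sum>b<Suc n. B (x b) (symmetrized_fold B (x \<circ> Transposition.transpose n b) n v))"
    by (simp add: symmetrized_fold_def linear_sum[OF linear_B])
  finally show ?thesis .
qed

lemma sqrt_mi_fact_scaleR_skorohod:
  assumes linear_B: "\<And>k. linear (B k)"
  shows "sqrt (real (mi_fact \<alpha>)) *\<^sub>R skorohod B u \<alpha>
    = (\<Sum>k\<in>Poly_Mapping.keys \<alpha>. real (Poly_Mapping.lookup \<alpha> k) *\<^sub>R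
        B k (sqrt (real (mi_fact (\<alpha> - mi_unit k))) *\<^sub>R u (\<alpha> - mi_unit k)))"
  unfolding skorohod_def scaleR_sum_right
  by (intro sum.cong refl) (simp add: linear_scale[OF linear_B] mi_fact_diff_mi_unit real_sqrt_mult)

lemma propagator_symmetrized_fold:
  assumes linear_B: "\<And>k. linear (B k)" and propagator_u: "propagator B u" and enumerates_x: "enumerates x n \<alpha>"
  shows "sqrt (real (mi_fact \<alpha>)) *\<^sub>R u \<alpha> = symmetrized_fold B x n (u 0)"
  using enumerates_x
proof (induction n arbitrary: x \<alpha>)
  case 0
  then show ?case
    using enumerates_0 by force
next
  case (Suc n)
  let ?g = "\<lambda>k. B k (sqrt (real (mi_fact (\<alpha> - mi_unit k))) *\<^sub>R u (\<alpha> - mi_unit k))"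
  have "\<alpha> \<noteq> 0"
    using enumerates_image[OF Suc.prems] by force
  have "symmetrized_fold B x (Suc n) (u 0)
      = (\<Sum>b<Suc n. B (x b) (symmetrized_fold B (x \<circ> Transposition.transpose n b) n (u 0)))"
    by (rule symmetrized_fold_Suc[OF linear_B])
  also have "\<dots> = (\<Sum>b<Suc n. ?g (x b))"
    by (intro sum.cong refl) (simp only: Suc.IH[OF enumerates_transpose[OF Suc.prems]] lessThan_iff)
  also have "\<dots> = (\<Sum>k\<in>Poly_Mapping.keys \<alpha>. real (Poly_Mapping.lookup \<alpha> k) *\<^sub>R ?g k)"
    by (rule sum_enumerates[OF Suc.prems])
  also have "\<dots> = sqrt (real (mi_fact \<alpha>)) *\<^sub>R u \<alpha>"
    by (simp add: sqrt_mi_fact_scaleR_skorohod[OF linear_B] propagatorD[OF propagator_u \<open>\<alpha> \<noteq> 0\<close>])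
  finally show ?case ..
qed

corollary propagator_coefficient:
  assumes "\<And>k. linear (B k)" "propagator B u"
  shows "u \<alpha> = (1 / sqrt (real (mi_fact \<alpha>))) *\<^sub>R
    symmetrized_fold B ((!) (characteristic_set \<alpha>)) (mi_deg \<alpha>) (u 0)"
  using mi_fact_pos[of \<alpha>]
  by (simp flip: propagator_symmetrized_fold[OF assms enumerates_characteristic_set])

subsection \<open>Homogeneous parts and iterated Skorohod operators\<close>

definition truncation :: "'i set \<Rightarrow> ('i \<Rightarrow> 'v) \<Rightarrow> 'i \<Rightarrow> 'v :: zero" where
  "truncation A v \<alpha> = (if \<alpha> \<in> A then v \<alpha> else 0)"

abbreviation homogeneous_part :: "nat \<Rightarrow> 'v chaos_series \<Rightarrow> 'v :: zero chaos_series" where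
  "homogeneous_part n \<equiv> truncation {\<alpha>. mi_deg \<alpha> = n}"

lemma homogeneous_part_0: "homogeneous_part 0 v = nonrandom (v 0)"
  by (auto simp: truncation_def nonrandom_def mi_deg_eq_0_iff)

lemma skorohod_homogeneous_part:
  assumes linear_B: "\<And>k. linear (B k)"
  shows "skorohod B (homogeneous_part n w) = homogeneous_part (Suc n) (skorohod B w)"
proof
  fix \<alpha>
  have "skorohod B (homogeneous_part n w) \<alpha> = (\<Sum>k\<in>Poly_Mapping.keys \<alpha>. if mi_deg \<alpha> = Suc n
      then sqrt (real (Poly_Mapping.lookup \<alpha> k)) *\<^sub>R B k (w (\<alpha> - mi_unit k)) else 0)"
    unfolding skorohod_def
    by (intro sum.cong) (auto simp: truncation_def mi_deg_diff_mi_unit linear_0[OF linear_B])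
  then show "skorohod B (homogeneous_part n w) \<alpha> = homogeneous_part (Suc n) (skorohod B w) \<alpha>"
    by (simp add: truncation_def skorohod_def)
qed

lemma skorohod_iter_propagator:
  assumes linear_B: "\<And>k. linear (B k)" and propagator_w: "propagator B w"
  shows "skorohod_iter B n (nonrandom (w 0)) = homogeneous_part n w"
proof (induction n)
  case 0
  show ?case
    by (simp add: homogeneous_part_0)
next
  case (Suc n)
  have "homogeneous_part (Suc n) (skorohod B w) = homogeneous_part (Suc n) w"
  proof
    show "homogeneous_part (Suc n) (skorohod B w) \<alpha> = homogeneous_part (Suc n) w \<alpha>" for \<alpha>
      by (cases "\<alpha> = 0") (simp_all add: truncation_def flip: propagatorD[OF propagator_w])
  qed
  then show ?case
    by (simp add: Suc skorohod_homogeneous_part[OF linear_B])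
qed

lemma sum_homogeneous_parts:
  fixes w :: "'v :: real_vector chaos_series"
  shows "(\<lambda>\<alpha>. \<Sum>n\<le>N. b n *\<^sub>R homogeneous_part n w \<alpha>)
    = truncation {\<alpha>. mi_deg \<alpha> \<le> N} (weight_op (\<lambda>\<alpha>. b (mi_deg \<alpha>)) w)"
  by (auto simp: truncation_def weight_op_def if_distrib cong: if_cong)

lemma homogeneous_parts_sums:
  fixes w :: "'v :: real_normed_vector chaos_series"
  shows "(\<lambda>n. b (Suc n) *\<^sub>R homogeneous_part (Suc n) w \<alpha>)
    sums (weight_op (\<lambda>\<alpha>. b (mi_deg \<alpha>)) w \<alpha> - nonrandom (b 0 *\<^sub>R w 0) \<alpha>)"
proof -
  have "(\<lambda>n. b n *\<^sub>R homogeneous_part n w \<alpha>) = (\<lambda>n. if n = mi_deg \<alpha> then b n *\<^sub>R w \<alpha> else 0)"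
    by (auto simp: truncation_def)
  also have "\<dots> sums weight_op (\<lambda>\<alpha>. b (mi_deg \<alpha>)) w \<alpha>"
    unfolding weight_op_def by (rule sums_single)
  finally show ?thesis
    by (subst sums_Suc_iff) (auto simp: homogeneous_part_0 nonrandom_def)
qed

lemma skorohod_iter_scaled_propagator:
  assumes linear_B: "\<And>k. linear (B k)" and propagator_u: "propagator B u"
  shows "skorohod_iter (\<lambda>k v. q k *\<^sub>R B k v) n (nonrandom (u 0))
    = homogeneous_part n (weight_op (mi_power q) u)"
proof -
  have "linear (\<lambda>v. q k *\<^sub>R B k v)" for k
    by (intro linear_compose_scale_right linear_B)
  from skorohod_iter_propagator[OF this propagator_weight_op[OF linear_B propagator_u]] show ?thesis
    by (simp add: weight_op_def)
qed

corollary skorohod_iter_sums: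
  fixes B :: "nat \<Rightarrow> 'v \<Rightarrow> 'v :: real_normed_vector"
  assumes "\<And>k. linear (B k)" "propagator B u"
  shows "(\<lambda>n. (1 / sqrt (fact (Suc n))) *\<^sub>R
      skorohod_iter (\<lambda>k v. q k *\<^sub>R B k v) (Suc n) (nonrandom (u 0)) \<alpha>)
    sums (weight_op (chaos_weight q) u \<alpha> - nonrandom (u 0) \<alpha>)"
  using homogeneous_parts_sums[of "\<lambda>n. 1 / sqrt (fact n)" "weight_op (mi_power q) u" \<alpha>]
  unfolding skorohod_iter_scaled_propagator[OF assms] weight_op_chaos_weight
  by (simp add: weight_op_def)

subsection \<open>Square-summable series\<close>

definition square_summable :: "('i \<Rightarrow> 'v :: real_normed_vector) \<Rightarrow> bool" where
  "square_summable v \<longleftrightarrow> (\<lambda>\<alpha>. (norm (v \<alpha>))\<^sup>2) summable_on UNIV"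

lemma weighted_L2_iff: "u \<in> weighted_L2 r \<longleftrightarrow> square_summable (weight_op r u)"
  by (simp add: weighted_L2_def square_summable_def weight_op_def power_mult_distrib)

context
  fixes y :: "multi_index \<Rightarrow> real" and x :: "nat \<Rightarrow> real"
  assumes y_nonneg: "\<And>\<alpha>. y \<alpha> \<ge> 0" and x_nonneg: "\<And>k. x k \<ge> 0" and summable_x: "summable x"
    and y_le: "\<And>\<alpha>. \<alpha> \<noteq> 0 \<Longrightarrow> y \<alpha> \<le> (\<Sum>k\<in>Poly_Mapping.keys \<alpha>. x k * y (\<alpha> - mi_unit k))"
begin

text \<open>Summing the bound on \<open>y\<close> over a level meets each pair \<open>(k, \<alpha> - \<epsilon>\<^sub>k)\<close> at most once.\<close>

lemma level_sum_Suc_le: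
  assumes F: "finite F" "\<And>\<alpha>. \<alpha> \<in> F \<Longrightarrow> mi_deg \<alpha> = Suc n"
  obtains G where "finite G" "\<And>\<beta>. \<beta> \<in> G \<Longrightarrow> mi_deg \<beta> = n" "sum y F \<le> suminf x * sum y G"
proof -
  define D where "D = Sigma F Poly_Mapping.keys"
  define h where "h = (\<lambda>(\<alpha>, k). (k, \<alpha> - mi_unit k :: multi_index))"
  have inj: "inj_on h D"
    by (rule inj_on_inverseI[where g = "\<lambda>(k, \<beta>). (\<beta> + mi_unit k, k)"])
      (auto simp: D_def h_def diff_add_mi_unit simp del: One_nat_def)
  have finite_D: "finite D"
    using F(1) by (auto simp: D_def)
  let ?K = "fst ` h ` D" and ?G = "snd ` h ` D"
  have "sum y F \<le> (\<Sum>\<alpha>\<in>F. \<Sum>k\<in>Poly_Mapping.keys \<alpha>. x k * y (\<alpha> - mi_unit k))"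
    using F(2) by (intro sum_mono y_le) force
  also have "\<dots> = (\<Sum>p\<in>D. case h p of (k, \<beta>) \<Rightarrow> x k * y \<beta>)"
    unfolding D_def using F(1) by (subst sum.Sigma) (auto simp: h_def intro!: sum.cong)
  also have "\<dots> = (\<Sum>(k, \<beta>)\<in>h ` D. x k * y \<beta>)"
    by (subst sum.reindex[OF inj]) (simp add: comp_def)
  also have "\<dots> \<le> (\<Sum>(k, \<beta>)\<in>?K \<times> ?G. x k * y \<beta>)"
    using finite_D x_nonneg y_nonneg by (intro sum_mono2 subset_fst_snd) auto
  also have "\<dots> = sum x ?K * sum y ?G"
    by (simp add: sum_product sum.cartesian_product)
  also have "\<dots> \<le> suminf x * sum y ?G"
    using finite_D x_nonneg y_nonneg by (intro mult_right_mono sum_le_suminf summable_x sum_nonneg) auto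
  finally have "sum y F \<le> suminf x * sum y ?G" .
  moreover have "mi_deg \<beta> = n" if "\<beta> \<in> ?G" for \<beta>
    using that F(2) by (auto simp: D_def h_def dest: mi_deg_diff_mi_unit)
  ultimately show ?thesis
    using finite_D by (intro that[of ?G]) auto
qed

lemma level_sum_le:
  assumes "finite F" "\<And>\<alpha>. \<alpha> \<in> F \<Longrightarrow> mi_deg \<alpha> = n"
  shows "sum y F \<le> suminf x ^ n * y 0"
  using assms
proof (induction n arbitrary: F)
  case 0
  then have "F \<subseteq> {0}"
    by (auto simp: mi_deg_eq_0_iff)
  then show ?case
    using sum_mono2[of "{0}" F y] y_nonneg by auto
next
  case (Suc n)
  obtain G where G: "finite G" "\<And>\<beta>. \<beta> \<in> G \<Longrightarrow> mi_deg \<beta> = n" "sum y F \<le> suminf x * sum y G"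
    using level_sum_Suc_le[OF Suc.prems] by blast
  note G(3)
  also have "suminf x * sum y G \<le> suminf x * (suminf x ^ n * y 0)"
    using G(1,2) by (intro mult_left_mono Suc.IH suminf_nonneg summable_x x_nonneg) auto
  finally show ?case
    by simp
qed

lemma summable_on_multi_indices:
  assumes "suminf x < 1"
  shows "y summable_on UNIV"
proof (rule nonneg_bdd_above_summable_on)
  have suminf_x: "0 \<le> suminf x"
    by (intro suminf_nonneg summable_x x_nonneg)
  have "sum y F \<le> 1 / (1 - suminf x) * y 0" if "finite F" for F
  proof -
    have "sum y F = (\<Sum>n\<in>mi_deg ` F. sum y {\<alpha> \<in> F. mi_deg \<alpha> = n})"
      using that by (rule sum.image_gen)
    also have "\<dots> \<le> (\<Sum>n\<in>mi_deg ` F. suminf x ^ n * y 0)"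
      using that by (intro sum_mono level_sum_le) auto
    also have "\<dots> = (\<Sum>n\<in>mi_deg ` F. suminf x ^ n) * y 0"
      by (simp add: sum_distrib_right)
    also have "\<dots> \<le> suminf (\<lambda>n. suminf x ^ n) * y 0"
      using that suminf_x assms by (intro mult_right_mono sum_le_suminf summable_geometric y_nonneg) auto
    also have "\<dots> = 1 / (1 - suminf x) * y 0"
      using suminf_x assms by (subst suminf_geometric) auto
    finally show ?thesis .
  qed
  then show "bdd_above (sum y ` {F. F \<subseteq> UNIV \<and> finite F})"
    by (auto intro!: bdd_aboveI2)
qed (rule y_nonneg)

end

lemma norm_skorohod_sq_le:
  fixes B :: "nat \<Rightarrow> 'v :: real_normed_vector \<Rightarrow> 'w :: real_normed_vector"
  assumes bound_B: "\<And>k v. norm (B k v) \<le> c k * norm v"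
  shows "(norm (skorohod B w \<alpha>))\<^sup>2
    \<le> real (mi_deg \<alpha>) * (\<Sum>k\<in>Poly_Mapping.keys \<alpha>. (c k)\<^sup>2 * (norm (w (\<alpha> - mi_unit k)))\<^sup>2)"
proof -
  let ?K = "Poly_Mapping.keys \<alpha>" and ?a = "\<lambda>k. sqrt (real (Poly_Mapping.lookup \<alpha> k))"
    and ?b = "\<lambda>k. c k * norm (w (\<alpha> - mi_unit k))"
  have "norm (skorohod B w \<alpha>) \<le> (\<Sum>k\<in>?K. ?a k * ?b k)"
    unfolding skorohod_def by (rule sum_norm_le) (auto intro!: mult_left_mono bound_B)
  then have "(norm (skorohod B w \<alpha>))\<^sup>2 \<le> (\<Sum>k\<in>?K. ?a k * ?b k)\<^sup>2"
    by (intro power_mono) auto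
  also have "\<dots> \<le> (\<Sum>k\<in>?K. (?a k)\<^sup>2) * (\<Sum>k\<in>?K. (?b k)\<^sup>2)"
    by (rule Cauchy_Schwarz_ineq_sum)
  also have "\<dots> = real (mi_deg \<alpha>) * (\<Sum>k\<in>?K. (c k)\<^sup>2 * (norm (w (\<alpha> - mi_unit k)))\<^sup>2)"
    by (simp add: mi_deg_def power_mult_distrib)
  finally show ?thesis .
qed

lemma propagator_square_summable:
  fixes B :: "nat \<Rightarrow> 'v \<Rightarrow> 'v :: real_normed_vector"
  assumes bound_B: "\<And>k v. norm (B k v) \<le> c k * norm v" and propagator_w: "propagator B w"
    and contraction: "summable (\<lambda>k. (c k)\<^sup>2)" "suminf (\<lambda>k. (c k)\<^sup>2) < 1"
  shows "square_summable (weight_op (\<lambda>\<alpha>. 1 / sqrt (fact (mi_deg \<alpha>))) w)"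
proof -
  define y where "y \<alpha> = (norm (w \<alpha>))\<^sup>2 / fact (mi_deg \<alpha>)" for \<alpha>
  have "y summable_on UNIV"
  proof (rule summable_on_multi_indices[OF _ _ contraction(1) _ contraction(2)])
    fix \<alpha> :: multi_index assume "\<alpha> \<noteq> 0"
    let ?n = "mi_deg \<alpha>" and ?K = "Poly_Mapping.keys \<alpha>"
    have "?n \<noteq> 0"
      using \<open>\<alpha> \<noteq> 0\<close> by (simp add: mi_deg_eq_0_iff)
    have "y \<alpha> \<le> real ?n * (\<Sum>k\<in>?K. (c k)\<^sup>2 * (norm (w (\<alpha> - mi_unit k)))\<^sup>2) / fact ?n"
      unfolding y_def by (subst propagatorD[OF propagator_w \<open>\<alpha> \<noteq> 0\<close>])
        (intro divide_right_mono norm_skorohod_sq_le bound_B, simp)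
    also have "\<dots> = (\<Sum>k\<in>?K. (c k)\<^sup>2 * (norm (w (\<alpha> - mi_unit k)))\<^sup>2) / fact (?n - 1)"
      using \<open>?n \<noteq> 0\<close> by (simp add: fact_reduce)
    also have "\<dots> = (\<Sum>k\<in>?K. (c k)\<^sup>2 * y (\<alpha> - mi_unit k))"
      unfolding sum_divide_distrib y_def by (intro sum.cong) (auto dest: mi_deg_diff_mi_unit)
    finally show "y \<alpha> \<le> (\<Sum>k\<in>?K. (c k)\<^sup>2 * y (\<alpha> - mi_unit k))" .
  qed (simp_all add: y_def)
  then show ?thesis
    by (simp add: square_summable_def weight_op_def power_divide flip: y_def)
qed

corollary propagator_in_weighted_L2:
  fixes B :: "nat \<Rightarrow> 'v \<Rightarrow> 'v :: real_normed_vector"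
  assumes linear_B: "\<And>k. linear (B k)" and bound_B: "\<And>k v. norm (B k v) \<le> c k * norm v"
    and propagator_u: "propagator B u"
    and contraction: "summable (\<lambda>k. (q k)\<^sup>2 * (c k)\<^sup>2)" "suminf (\<lambda>k. (q k)\<^sup>2 * (c k)\<^sup>2) < 1"
  shows "u \<in> weighted_L2 (chaos_weight q)"
proof -
  have "norm (q k *\<^sub>R B k v) \<le> (\<bar>q k\<bar> * c k) * norm v" for k v
    using mult_left_mono[OF bound_B, of "\<bar>q k\<bar>"] by (simp add: mult.assoc)
  then have "square_summable (weight_op (\<lambda>\<alpha>. 1 / sqrt (fact (mi_deg \<alpha>))) (weight_op (mi_power q) u))"
    using propagator_weight_op[OF linear_B propagator_u]
      by (rule propagator_square_summable) (use contraction in \<open>simp_all add: power_mult_distrib\<close>)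
  then show ?thesis
    by (simp add: weighted_L2_iff weight_op_chaos_weight)
qed

subsection \<open>Moments of the standard normal law\<close>

fun gauss_moment :: "nat \<Rightarrow> real" where
  "gauss_moment 0 = 1"
| "gauss_moment (Suc 0) = 0"
| "gauss_moment (Suc (Suc n)) = real (Suc n) * gauss_moment n"

lemma gauss_moment_Suc: "gauss_moment (Suc n) = real n * gauss_moment (n - 1)"
  by (cases n) auto

lemma gauss_moment_even: "gauss_moment (2 * k) = fact (2 * k) / (2 ^ k * fact k)"
proof (induction k)
  case (Suc k)
  have "fact (2 * Suc k) = (2 * real (Suc k)) * (real (2 * k + 1) * fact (2 * k))"
    by (simp add: algebra_simps)
  then have "fact (2 * Suc k) / (2 ^ Suc k * fact (Suc k))
      = real (2 * k + 1) * (fact (2 * k) / (2 ^ k * fact k))"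
    unfolding fact_Suc[of k] power_Suc by (simp add: divide_simps del: fact_Suc of_nat_Suc)
  then show ?case
    by (simp add: Suc.IH del: fact_Suc)
qed simp

lemma gauss_moment_odd: "gauss_moment (Suc (2 * k)) = 0"
  by (induction k) simp_all

lemma has_bochner_integral_normal_moment:
  assumes "0 < \<sigma>"
  shows "has_bochner_integral lborel (\<lambda>x. normal_density 0 \<sigma> x * x ^ n) (gauss_moment n * \<sigma> ^ n)"
proof (cases "even n")
  case True
  then obtain k where n: "n = 2 * k"
    by (auto elim: evenE)
  have "fact (2 * k) / ((2 / \<sigma>\<^sup>2) ^ k * fact k) = gauss_moment n * \<sigma> ^ n"
    by (simp add: n gauss_moment_even power_divide power_mult)
  then show ?thesis
    using normal_moment_even[OF assms, of 0 k] by (simp add: n)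
next
  case False
  then obtain k where n: "n = 2 * k + 1"
    by (auto elim: oddE)
  then show ?thesis
    using normal_moment_odd[OF assms, of 0 k] by (simp add: gauss_moment_odd del: gauss_moment.simps)
qed

text \<open>The recursion \<open>a\<^bsub>n+1\<^esub> = n p a\<^bsub>n-1\<^esub>\<close> of the moments of a centred normal law of variance \<open>p\<close> says
  that the exponential generating function \<open>F\<close> of \<open>a\<close> satisfies \<open>F' = p X F\<close>, so variances add up in
  products.\<close>

lemma fps_deriv_egf_iff:
  fixes a :: "nat \<Rightarrow> real"
  defines "F \<equiv> Abs_fps (\<lambda>n. a n / fact n)"
  shows "fps_deriv F = fps_const p * fps_X * F \<longleftrightarrow> (\<forall>n. a (Suc n) = real n * p * a (n - 1))"
proof -
  have "fps_nth (fps_deriv F) n = fps_nth (fps_const p * fps_X * F) n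
      \<longleftrightarrow> a (Suc n) = real n * p * a (n - 1)" for n
    by (cases n) (auto simp: F_def mult.assoc divide_simps simp del: of_nat_Suc)
  then show ?thesis
    by (simp add: fps_eq_iff)
qed

lemma binomial_convolution_recursion:
  fixes a b :: "nat \<Rightarrow> real"
  defines "c \<equiv> \<lambda>n. \<Sum>i\<le>n. real (n choose i) * a i * b (n - i)"
  assumes recursion_a: "\<And>n. a (Suc n) = real n * p * a (n - 1)"
    and recursion_b: "\<And>n. b (Suc n) = real n * q * b (n - 1)"
  shows "c (Suc n) = real n * (p + q) * c (n - 1)"
proof -
  let ?egf = "\<lambda>a :: nat \<Rightarrow> real. Abs_fps (\<lambda>n. a n / fact n)"
  have egf_c: "?egf c = ?egf a * ?egf b"
  proof (rule fps_ext)
    fix n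
    have "c n / fact n = (\<Sum>i\<le>n. (a i / fact i) * (b (n - i) / fact (n - i)))"
      unfolding c_def sum_divide_distrib
      by (intro sum.cong refl) (simp add: binomial_fact)
    then show "fps_nth (?egf c) n = fps_nth (?egf a * ?egf b) n"
      by (simp add: fps_mult_nth atLeast0AtMost)
  qed
  have "fps_deriv (?egf a) = fps_const p * fps_X * ?egf a" "fps_deriv (?egf b) = fps_const q * fps_X * ?egf b"
    using recursion_a recursion_b by (simp_all add: fps_deriv_egf_iff)
  then have "fps_deriv (?egf c) = fps_const (p + q) * fps_X * ?egf c"
    by (simp add: egf_c algebra_simps flip: fps_const_add)
  then show ?thesis
    by (simp add: fps_deriv_egf_iff)
qed

lemma gauss_moment_unique:
  assumes "\<And>n. c (Suc n) = real n * q * c (n - 1)" "q \<ge> 0"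
  shows "c n = c 0 * gauss_moment n * sqrt q ^ n"
proof (induction n rule: gauss_moment.induct)
  case 2
  show ?case
    using assms(1)[of 0] by simp
next
  case (3 n)
  then show ?case
    using assms(1)[of "Suc n"] \<open>q \<ge> 0\<close> by simp
qed simp

lemma gauss_moment_convolution:
  fixes s t :: real
  shows "(\<Sum>i\<le>n. real (n choose i) * (gauss_moment i * t ^ i) * (gauss_moment (n - i) * s ^ (n - i)))
    = gauss_moment n * sqrt (t\<^sup>2 + s\<^sup>2) ^ n"
proof -
  have "gauss_moment (Suc n) * r ^ Suc n = real n * r\<^sup>2 * (gauss_moment (n - 1) * r ^ (n - 1))" for r n
    by (cases n) (simp_all add: power2_eq_square)
  note recursion = binomial_convolution_recursion[OF this this]
  show ?thesis
    by (subst gauss_moment_unique[OF recursion]) auto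
qed

definition gauss_expectation :: "real poly \<Rightarrow> real" where
  "gauss_expectation p = (\<Sum>i\<le>degree p. coeff p i * gauss_moment i)"

lemma gauss_expectation_altdef:
  assumes "degree p \<le> n"
  shows "gauss_expectation p = (\<Sum>i\<le>n. coeff p i * gauss_moment i)"
  unfolding gauss_expectation_def using assms
  by (intro sum.mono_neutral_left) (auto simp: coeff_eq_0)

lemma gauss_expectation_0 [simp]: "gauss_expectation 0 = 0"
  by (simp add: gauss_expectation_def)

lemma gauss_expectation_1 [simp]: "gauss_expectation 1 = 1"
  by (simp add: gauss_expectation_def)

lemma gauss_expectation_diff: "gauss_expectation (p - q) = gauss_expectation p - gauss_expectation q"
proof -
  define n where "n = max (degree p) (degree q)"
  have "degree p \<le> n" "degree q \<le> n" "degree (p - q) \<le> n"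
    by (auto simp: n_def intro: degree_diff_le_max)
  then show ?thesis
    by (simp add: gauss_expectation_altdef sum_subtractf left_diff_distrib)
qed

lemma gauss_expectation_smult: "gauss_expectation (smult c p) = c * gauss_expectation p"
  by (simp add: gauss_expectation_altdef[of _ "degree p"] degree_smult_le sum_distrib_left mult.assoc)

lemma gauss_expectation_integration_by_parts:
  "gauss_expectation (pCons 0 p) = gauss_expectation (pderiv p)"
proof -
  define n where "n = degree p"
  have "gauss_expectation (pCons 0 p) = (\<Sum>i\<le>Suc n. coeff (pCons 0 p) i * gauss_moment i)"
    by (rule gauss_expectation_altdef) (simp add: n_def degree_pCons_le)
  also have "\<dots> = (\<Sum>i\<le>n. coeff p i * gauss_moment (Suc i))"
    by (subst sum.atMost_Suc_shift) simp
  also have "\<dots> = (\<Sum>i\<le>Suc n. real i * coeff p i * gauss_moment (i - 1))"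
    by (simp add: gauss_moment_Suc n_def coeff_eq_0 mult_ac)
  also have "\<dots> = (\<Sum>i\<le>n. real (Suc i) * coeff p (Suc i) * gauss_moment i)"
    by (subst sum.atMost_Suc_shift) simp
  also have "\<dots> = gauss_expectation (pderiv p)"
    by (subst gauss_expectation_altdef[of _ n]) (auto simp: coeff_pderiv degree_pderiv n_def)
  finally show ?thesis .
qed

subsection \<open>Hermite polynomials\<close>

primrec hermite_poly :: "nat \<Rightarrow> real poly" where
  "hermite_poly 0 = 1"
| "hermite_poly (Suc n) = pCons 0 (hermite_poly n) - pderiv (hermite_poly n)"

lemma hermite_eq_poly: "hermite n x = poly (hermite_poly n) x"
proof -
  have "(deriv ^^ n) (\<lambda>y::real. exp (- (y\<^sup>2) / 2))
    = (\<lambda>y. (-1) ^ n * poly (hermite_poly n) y * exp (- (y\<^sup>2) / 2))"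
  proof (induction n)
    case (Suc n)
    have "deriv (\<lambda>y. (-1) ^ n * poly (hermite_poly n) y * exp (- (y\<^sup>2) / 2)) x
      = (-1) ^ Suc n * poly (hermite_poly (Suc n)) x * exp (- (x\<^sup>2) / 2)" for x
      by (rule DERIV_imp_deriv) (auto intro!: derivative_eq_intros poly_DERIV simp: algebra_simps)
    then show ?case
      by (simp only: funpow.simps comp_apply Suc.IH)
  qed simp
  then show ?thesis
    by (simp add: hermite_def mult_ac flip: exp_add power_add mult_2)
qed

lemma pderiv_hermite_poly: "pderiv (hermite_poly n) = smult (real n) (hermite_poly (n - 1))"
proof (induction n)
  case (Suc n)
  have "pCons 0 (pderiv (hermite_poly n)) - pderiv (pderiv (hermite_poly n)) = smult (real n) (hermite_poly n)"
    unfolding Suc.IH pderiv_smult by (cases n) (simp_all add: smult_diff_right del: of_nat_Suc)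
  moreover have "pderiv (hermite_poly (Suc n))
      = hermite_poly n + (pCons 0 (pderiv (hermite_poly n)) - pderiv (pderiv (hermite_poly n)))"
    by (simp add: pderiv_diff pderiv_pCons)
  ultimately show ?case
    by (simp add: smult_add_left)
qed (simp add: pderiv_1)

lemma higher_pderiv_hermite_poly:
  "(pderiv ^^ m) (hermite_poly n) = smult (\<Prod>i<m. real (n - i)) (hermite_poly (n - m))"
  by (induction m) (simp_all add: pderiv_smult pderiv_hermite_poly diff_commute mult.commute)

lemma gauss_expectation_hermite_poly_mult:
  "gauss_expectation (hermite_poly n * p) = gauss_expectation ((pderiv ^^ n) p)"
proof (induction n arbitrary: p)
  case (Suc n)
  have "gauss_expectation (hermite_poly (Suc n) * p)
      = gauss_expectation (pderiv (hermite_poly n * p)) - gauss_expectation (pderiv (hermite_poly n) * p)"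
    by (simp add: left_diff_distrib gauss_expectation_diff flip: gauss_expectation_integration_by_parts)
  also have "\<dots> = gauss_expectation (hermite_poly n * pderiv p)"
    by (simp add: pderiv_mult mult.commute flip: gauss_expectation_diff)
  finally show ?case
    by (simp add: Suc funpow_Suc_right del: funpow.simps)
qed simp

lemma gauss_expectation_hermite_poly_orthogonal:
  "gauss_expectation (hermite_poly m * hermite_poly n) = (if m = n then fact n else 0)"
proof (induction n m rule: linorder_wlog)
  case (le n m)
  have "(\<Prod>i<m. real (n - i)) = (if m = n then fact n else 0)"
    using le by (auto simp: fact_prod_rev atLeast0LessThan intro!: bexI[of _ n])
  then show ?case
    by (simp add: gauss_expectation_hermite_poly_mult higher_pderiv_hermite_poly gauss_expectation_smult)
qed (auto simp: mult.commute)

subsection \<open>Random variables with moments of all orders\<close>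

context prob_space
begin

definition has_moments :: "('a \<Rightarrow> real) \<Rightarrow> bool" where
  "has_moments X \<longleftrightarrow> X \<in> borel_measurable M \<and> (\<forall>n. integrable M (\<lambda>\<omega>. X \<omega> ^ n))"

lemma has_moments_measurable: "has_moments X \<Longrightarrow> X \<in> borel_measurable M"
  by (simp add: has_moments_def)

lemma has_moments_integrable: "has_moments X \<Longrightarrow> integrable M X"
  by (auto simp: has_moments_def dest: spec[of _ 1])

lemma has_moments_const: "has_moments (\<lambda>_. c)"
  by (simp add: has_moments_def)

lemma has_moments_mult:
  assumes "has_moments X" "has_moments Y"
  shows "has_moments (\<lambda>\<omega>. X \<omega> * Y \<omega>)"
  unfolding has_moments_def
proof (intro conjI allI)
  have [measurable]: "X \<in> borel_measurable M" "Y \<in> borel_measurable M"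
    using assms by (auto intro: has_moments_measurable)
  show "(\<lambda>\<omega>. X \<omega> * Y \<omega>) \<in> borel_measurable M"
    by measurable
  fix n
  show "integrable M (\<lambda>\<omega>. (X \<omega> * Y \<omega>) ^ n)"
  proof (rule Bochner_Integration.integrable_bound)
    show "integrable M (\<lambda>\<omega>. X \<omega> ^ (2 * n) + Y \<omega> ^ (2 * n))"
      using assms unfolding has_moments_def by (intro Bochner_Integration.integrable_add) blast+
    have "\<bar>(x * y) ^ n\<bar> \<le> x ^ (2 * n) + y ^ (2 * n)" for x y :: real
    proof -
      have "2 * (\<bar>x ^ n\<bar> * \<bar>y ^ n\<bar>) \<le> (x ^ n)\<^sup>2 + (y ^ n)\<^sup>2"
        using sum_squares_bound[of "\<bar>x ^ n\<bar>" "\<bar>y ^ n\<bar>"] by (simp add: mult.assoc)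
      moreover have "0 \<le> \<bar>x ^ n\<bar> * \<bar>y ^ n\<bar>"
        by simp
      ultimately show ?thesis
        unfolding power_mult_distrib abs_mult power_even_eq by linarith
    qed
    then show "AE \<omega> in M. norm ((X \<omega> * Y \<omega>) ^ n) \<le> norm (X \<omega> ^ (2 * n) + Y \<omega> ^ (2 * n))"
      by (auto intro: order_trans[OF _ abs_ge_self])
  qed measurable
qed

lemma has_moments_power: "has_moments X \<Longrightarrow> has_moments (\<lambda>\<omega>. X \<omega> ^ n)"
  by (induction n) (auto intro: has_moments_const has_moments_mult)

lemma has_moments_add:
  assumes "has_moments X" "has_moments Y"
  shows "has_moments (\<lambda>\<omega>. X \<omega> + Y \<omega>)"
  unfolding has_moments_def
proof (intro conjI allI)
  show "(\<lambda>\<omega>. X \<omega> + Y \<omega>) \<in> borel_measurable M"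
    using assms by (intro borel_measurable_add has_moments_measurable)
  show "integrable M (\<lambda>\<omega>. (X \<omega> + Y \<omega>) ^ n)" for n
    unfolding binomial_ring mult.assoc
    by (intro Bochner_Integration.integrable_sum integrable_mult_right has_moments_integrable
        has_moments_mult has_moments_power assms)
qed

lemma has_moments_prod:
  "finite S \<Longrightarrow> (\<And>k. k \<in> S \<Longrightarrow> has_moments (X k)) \<Longrightarrow> has_moments (\<lambda>\<omega>. \<Prod>k\<in>S. X k \<omega>)"
  by (induction S rule: finite_induct) (auto intro: has_moments_const has_moments_mult)

lemma has_moments_poly: "has_moments X \<Longrightarrow> has_moments (\<lambda>\<omega>. poly p (X \<omega>))"
  by (induction p) (auto intro!: has_moments_const has_moments_add has_moments_mult)

lemma expectation_mult_poly:
  assumes moments_F: "has_moments F" and moments_X: "has_moments X"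
    and moments: "\<And>a. expectation (\<lambda>\<omega>. F \<omega> * X \<omega> ^ a) = g * gauss_moment a"
  shows "expectation (\<lambda>\<omega>. F \<omega> * poly p (X \<omega>)) = g * gauss_expectation p"
proof -
  have "expectation (\<lambda>\<omega>. F \<omega> * poly p (X \<omega>))
      = expectation (\<lambda>\<omega>. \<Sum>a\<le>degree p. coeff p a * (F \<omega> * X \<omega> ^ a))"
    by (simp add: poly_altdef sum_distrib_left mult_ac)
  also have "\<dots> = (\<Sum>a\<le>degree p. coeff p a * expectation (\<lambda>\<omega>. F \<omega> * X \<omega> ^ a))"
    by (subst Bochner_Integration.integral_sum)
      (auto intro!: integrable_mult_right has_moments_integrable has_moments_mult has_moments_power
        moments_F moments_X)
  finally show ?thesis
    by (simp add: moments gauss_expectation_def sum_distrib_left mult_ac)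
qed

lemma expectation_mult_binomial:
  assumes "has_moments F" "has_moments X" "has_moments Y"
  shows "expectation (\<lambda>\<omega>. F \<omega> * (t * X \<omega> + Y \<omega>) ^ n)
    = (\<Sum>i\<le>n. real (n choose i) * expectation (\<lambda>\<omega>. F \<omega> * X \<omega> ^ i * Y \<omega> ^ (n - i)) * t ^ i)"
proof -
  have "expectation (\<lambda>\<omega>. F \<omega> * (t * X \<omega> + Y \<omega>) ^ n)
    = expectation (\<lambda>\<omega>. \<Sum>i\<le>n. (real (n choose i) * t ^ i) * (F \<omega> * X \<omega> ^ i * Y \<omega> ^ (n - i)))"
    by (simp add: binomial_ring power_mult_distrib sum_distrib_left mult_ac)
  also have "\<dots> = (\<Sum>i\<le>n. (real (n choose i) * t ^ i) * expectation (\<lambda>\<omega>. F \<omega> * X \<omega> ^ i * Y \<omega> ^ (n - i)))"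
    by (subst Bochner_Integration.integral_sum)
      (auto intro!: integrable_mult_right has_moments_integrable has_moments_mult has_moments_power assms)
  finally show ?thesis
    by (simp add: mult_ac)
qed

text \<open>The moments of all linear combinations determine the mixed moments: compare the coefficients of
  the powers of \<open>t\<close>.\<close>

lemma gaussian_pencil_mixed_moment:
  assumes "has_moments F" "has_moments X" "has_moments Y"
    and pencil: "\<And>t n. expectation (\<lambda>\<omega>. F \<omega> * (t * X \<omega> + Y \<omega>) ^ n)
      = g * (gauss_moment n * sqrt (t\<^sup>2 + s\<^sup>2) ^ n)"
  shows "expectation (\<lambda>\<omega>. F \<omega> * X \<omega> ^ a * Y \<omega> ^ b) = g * gauss_moment a * (gauss_moment b * s ^ b)"
proof -
  define n where "n = a + b"
  let ?E = "\<lambda>i. expectation (\<lambda>\<omega>. F \<omega> * X \<omega> ^ i * Y \<omega> ^ (n - i))"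
    and ?m = "\<lambda>i. g * gauss_moment i * (gauss_moment (n - i) * s ^ (n - i))"
  have "(\<Sum>i\<le>n. real (n choose i) * ?E i * t ^ i) = (\<Sum>i\<le>n. real (n choose i) * ?m i * t ^ i)" for t
    unfolding expectation_mult_binomial[OF assms(1-3), symmetric] pencil gauss_moment_convolution[symmetric]
    by (simp add: sum_distrib_left mult_ac)
  then have "\<forall>i\<le>n. real (n choose i) * ?E i = real (n choose i) * ?m i"
    by (subst polyfun_eq_coeffs[symmetric]) blast
  from this[rule_format, of a] show ?thesis
    by (simp add: n_def)
qed

lemma centered_gaussian_moments:
  assumes "centered_gaussian M X"
  obtains \<sigma> where "\<And>n. has_bochner_integral M (\<lambda>\<omega>. X \<omega> ^ n) (gauss_moment n * \<sigma> ^ n)"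
proof -
  have [measurable]: "X \<in> borel_measurable M"
    using assms by (simp add: centered_gaussian_def)
  consider (degenerate) "AE \<omega> in M. X \<omega> = 0"
    | (normal) \<sigma> where "\<sigma> > 0" "distributed M lborel X (\<lambda>x. ennreal (normal_density 0 \<sigma> x))"
    using assms unfolding centered_gaussian_def by blast
  then show ?thesis
  proof cases
    case degenerate
    have "has_bochner_integral M (\<lambda>\<omega>. X \<omega> ^ n) (0 ^ n)" for n
    proof -
      have "has_bochner_integral M (\<lambda>_. 0 ^ n) (0 ^ n :: real)"
        by (simp add: has_bochner_integral_iff prob_space)
      moreover have "AE \<omega> in M. 0 ^ n = X \<omega> ^ n"
        using degenerate by eventually_elim simp
      ultimately show ?thesis
        by (subst has_bochner_integral_cong_AE[symmetric]) auto
    qed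
    moreover have "gauss_moment n * 0 ^ n = 0 ^ n" for n
      by (cases n) auto
    ultimately have "has_bochner_integral M (\<lambda>\<omega>. X \<omega> ^ n) (gauss_moment n * 0 ^ n)" for n
      by (simp only:)
    then show ?thesis
      by (rule that)
  next
    case normal
    have "has_bochner_integral M (\<lambda>\<omega>. X \<omega> ^ n) (gauss_moment n * \<sigma> ^ n)" for n
      using has_bochner_integral_normal_moment[OF \<open>\<sigma> > 0\<close>, of n]
        distributed_integrable[OF normal(2), of "\<lambda>x. x ^ n"] distributed_integral[OF normal(2), of "\<lambda>x. x ^ n"]
      by (auto simp: has_bochner_integral_iff)
    then show ?thesis
      by (rule that)
  qed
qed

end

subsection \<open>Mixed moments of orthonormal Gaussian sequences\<close>

locale orthonormal_gaussian_sequence = prob_space M for M :: "'a measure" +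
  fixes X :: "'i \<Rightarrow> 'a \<Rightarrow> real"
  assumes gaussian: "finite S \<Longrightarrow> centered_gaussian M (\<lambda>\<omega>. \<Sum>k\<in>S. c k * X k \<omega>)"
    and orthonormal: "expectation (\<lambda>\<omega>. X j \<omega> * X k \<omega>) = (if j = k then 1 else 0)"
begin

lemma has_moments_lincomb:
  assumes "finite S"
  shows "has_moments (\<lambda>\<omega>. \<Sum>k\<in>S. c k * X k \<omega>)"
proof -
  obtain \<sigma> where "\<And>n. has_bochner_integral M (\<lambda>\<omega>. (\<Sum>k\<in>S. c k * X k \<omega>) ^ n) (gauss_moment n * \<sigma> ^ n)"
    using centered_gaussian_moments[OF gaussian[OF assms, of c]] by blast
  then show ?thesis
    using gaussian[OF assms] by (auto simp: has_moments_def centered_gaussian_def has_bochner_integral_iff)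
qed

lemma has_moments_component: "has_moments (X k)"
  using has_moments_lincomb[of "{k}" "\<lambda>_. 1"] by simp

lemma lincomb_variance:
  assumes "finite S"
  shows "expectation (\<lambda>\<omega>. (\<Sum>k\<in>S. c k * X k \<omega>)\<^sup>2) = (\<Sum>k\<in>S. (c k)\<^sup>2)"
proof -
  have integrable: "integrable M (\<lambda>\<omega>. X j \<omega> * X k \<omega>)" for j k
    by (intro has_moments_integrable has_moments_mult has_moments_component)
  have "expectation (\<lambda>\<omega>. (\<Sum>k\<in>S. c k * X k \<omega>)\<^sup>2)
      = expectation (\<lambda>\<omega>. \<Sum>j\<in>S. \<Sum>k\<in>S. c j * c k * (X j \<omega> * X k \<omega>))"
    by (simp add: power2_eq_square sum_product mult_ac)
  also have "\<dots> = (\<Sum>j\<in>S. \<Sum>k\<in>S. c j * c k * expectation (\<lambda>\<omega>. X j \<omega> * X k \<omega>))"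
    by (simp add: Bochner_Integration.integral_sum integrable)
  also have "\<dots> = (\<Sum>k\<in>S. (c k)\<^sup>2)"
    using assms by (simp add: orthonormal power2_eq_square if_distrib sum.delta cong: if_cong)
  finally show ?thesis .
qed

lemma lincomb_moment:
  assumes "finite S"
  shows "expectation (\<lambda>\<omega>. (\<Sum>k\<in>S. c k * X k \<omega>) ^ n) = gauss_moment n * sqrt (\<Sum>k\<in>S. (c k)\<^sup>2) ^ n"
proof -
  obtain \<sigma> where "\<And>n. has_bochner_integral M (\<lambda>\<omega>. (\<Sum>k\<in>S. c k * X k \<omega>) ^ n) (gauss_moment n * \<sigma> ^ n)"
    using centered_gaussian_moments[OF gaussian[OF assms, of c]] by blast
  then have moment: "expectation (\<lambda>\<omega>. (\<Sum>k\<in>S. c k * X k \<omega>) ^ n) = gauss_moment n * \<sigma> ^ n" for n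
    by (rule has_bochner_integral_integral_eq)
  have "\<sigma>\<^sup>2 = (\<Sum>k\<in>S. (c k)\<^sup>2)"
    using lincomb_variance[OF assms, of c] unfolding moment by (simp add: numeral_2_eq_2)
  moreover have "gauss_moment n * \<sigma> ^ n = gauss_moment n * \<bar>\<sigma>\<bar> ^ n"
    by (cases "even n") (auto simp: gauss_moment_odd power_even_abs elim!: oddE)
  ultimately show ?thesis
    by (simp add: moment flip: real_sqrt_abs)
qed

lemma expectation_prod_poly_mult_lincomb:
  assumes "finite T" "finite S" "T \<inter> S = {}"
  shows "expectation (\<lambda>\<omega>. (\<Prod>k\<in>T. poly (p k) (X k \<omega>)) * (\<Sum>k\<in>S. c k * X k \<omega>) ^ b)
    = (\<Prod>k\<in>T. gauss_expectation (p k)) * (gauss_moment b * sqrt (\<Sum>k\<in>S. (c k)\<^sup>2) ^ b)"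
  using assms
proof (induction T arbitrary: S c b rule: finite_induct)
  case empty
  then show ?case
    by (simp add: lincomb_moment)
next
  case (insert l T)
  let ?Y = "\<lambda>\<omega>. \<Sum>k\<in>S. c k * X k \<omega>" and ?F = "\<lambda>\<omega>. \<Prod>k\<in>T. poly (p k) (X k \<omega>)"
    and ?g = "\<Prod>k\<in>T. gauss_expectation (p k)" and ?s = "sqrt (\<Sum>k\<in>S. (c k)\<^sup>2)"
  have S: "finite S" "l \<notin> S" "T \<inter> insert l S = {}"
    using insert by auto
  have moments_F: "has_moments ?F" and moments_Y: "has_moments ?Y"
    using insert.hyps S
      by (auto intro!: has_moments_prod has_moments_poly has_moments_component has_moments_lincomb)
  have sum_upd: "(\<Sum>k\<in>insert l S. h k ((c(l := t)) k)) = h l t + (\<Sum>k\<in>S. h k (c k))"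
    for h :: "'i \<Rightarrow> real \<Rightarrow> real" and t
    using S by (auto intro!: sum.cong)
  have "expectation (\<lambda>\<omega>. ?F \<omega> * (t * X l \<omega> + ?Y \<omega>) ^ n) = ?g * (gauss_moment n * sqrt (t\<^sup>2 + ?s\<^sup>2) ^ n)" for t n
    using insert.IH[of "insert l S" "c(l := t)" n] S
    by (simp add: sum_upd[of "\<lambda>k a. a * X k _"]
        sum_upd[of "\<lambda>k a. a\<^sup>2"] sum_nonneg del: sum.insert fun_upd_apply)
  then have "expectation (\<lambda>\<omega>. ?F \<omega> * X l \<omega> ^ a * ?Y \<omega> ^ b)
      = ?g * gauss_moment a * (gauss_moment b * ?s ^ b)" for a
    by (rule gaussian_pencil_mixed_moment[OF moments_F has_moments_component moments_Y])
  then have "expectation (\<lambda>\<omega>. (?F \<omega> * ?Y \<omega> ^ b) * poly (p l) (X l \<omega>))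
      = (?g * (gauss_moment b * ?s ^ b)) * gauss_expectation (p l)"
    by (intro expectation_mult_poly has_moments_mult has_moments_power moments_F moments_Y has_moments_component)
      (simp add: mult_ac)
  then show ?case
    using insert.hyps by (simp add: mult_ac)
qed

corollary expectation_prod_poly:
  assumes "finite T"
  shows "expectation (\<lambda>\<omega>. \<Prod>k\<in>T. poly (p k) (X k \<omega>)) = (\<Prod>k\<in>T. gauss_expectation (p k))"
  using expectation_prod_poly_mult_lincomb[of T "{}" p "\<lambda>_. 0" 0] assms by simp

end

subsection \<open>Exhaustion by finite index sets\<close>

lemma tendsto_infsum_Compl_0:
  fixes g :: "'i \<Rightarrow> real"
  assumes nonneg_summable: "g summable_on UNIV" "\<And>\<alpha>. g \<alpha> \<ge> 0" and eventually_A: "\<And>\<alpha>. \<forall>\<^sub>F i in F. \<alpha> \<in> A i"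
  shows "((\<lambda>i. infsum g (- A i)) \<longlongrightarrow> 0) F"
proof (rule tendstoI)
  fix \<epsilon> :: real assume "\<epsilon> > 0"
  have "(sum g \<longlongrightarrow> infsum g UNIV) (finite_subsets_at_top UNIV)"
    using has_sum_infsum[OF nonneg_summable(1)] by (simp add: has_sum_def)
  from tendstoD[OF this \<open>\<epsilon> > 0\<close>] obtain T where T: "finite T" "dist (sum g T) (infsum g UNIV) < \<epsilon>"
    unfolding eventually_finite_subsets_at_top by auto
  have "\<forall>\<^sub>F i in F. \<forall>\<alpha>\<in>T. \<alpha> \<in> A i"
    using T(1) eventually_A by (simp add: eventually_ball_finite_distrib)
  then show "\<forall>\<^sub>F i in F. dist (infsum g (- A i)) 0 < \<epsilon>"
  proof eventually_elim
    case (elim i)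
    have "infsum g (- A i) \<le> infsum g (UNIV - T)"
      using elim nonneg_summable by (intro infsum_mono2 summable_on_subset_banach[OF nonneg_summable(1)]) auto
    also have "\<dots> = infsum g UNIV - sum g T"
      using T(1) nonneg_summable(1) by (subst infsum_Diff) (auto intro: summable_on_finite)
    finally show ?case
      using T(2) infsum_nonneg[of "- A i" g] nonneg_summable(2) by (simp add: dist_real_def)
  qed
qed

lemma infsum_norm_truncation_sq:
  "(\<Sum>\<^sub>\<infinity>\<alpha>. (norm (truncation A v \<alpha>))\<^sup>2) = (\<Sum>\<^sub>\<infinity>\<alpha>\<in>A. (norm (v \<alpha>))\<^sup>2)"
  by (rule infsum_cong_neutral) (auto simp: truncation_def)

lemma norm_sq_dominated:
  assumes "norm x \<le> c * norm y"
  shows "(norm x)\<^sup>2 \<le> c\<^sup>2 * (norm y)\<^sup>2"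
  using power_mono[OF assms, of 2] by (simp add: power_mult_distrib)

lemma square_summable_dominated:
  assumes summable_v: "square_summable v" and dominated: "\<And>\<alpha>. norm (w \<alpha>) \<le> c * norm (v \<alpha>)"
  shows "square_summable w"
  unfolding square_summable_def
proof (rule summable_on_comparison_test)
  show "(\<lambda>\<alpha>. c\<^sup>2 * (norm (v \<alpha>))\<^sup>2) summable_on UNIV"
    using summable_v by (intro summable_on_cmult_right) (simp add: square_summable_def)
  show "(norm (w \<alpha>))\<^sup>2 \<le> c\<^sup>2 * (norm (v \<alpha>))\<^sup>2" for \<alpha>
    by (rule norm_sq_dominated[OF dominated])
qed simp

lemma square_summable_truncation: "square_summable v \<Longrightarrow> square_summable (truncation A v)"
  by (erule square_summable_dominated[where c = 1]) (simp add: truncation_def)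

definition rapidly_exhausts :: "(nat \<Rightarrow> 'i set) \<Rightarrow> ('i \<Rightarrow> 'v :: real_normed_vector) \<Rightarrow> bool" where
  "rapidly_exhausts S v \<longleftrightarrow> (\<forall>k. finite (S k)) \<and> incseq S \<and> square_summable v \<and>
    (\<exists>K. \<forall>k. (\<Sum>\<^sub>\<infinity>\<alpha>\<in>- S k. (norm (v \<alpha>))\<^sup>2) \<le> K / 4 ^ k)"

lemma ex_rapidly_exhausts:
  fixes v :: "'i \<Rightarrow> 'v :: real_normed_vector"
  assumes summable_v: "square_summable v"
  obtains S where "rapidly_exhausts S v"
proof -
  let ?g = "\<lambda>\<alpha>. (norm (v \<alpha>))\<^sup>2"
  have summable_g: "?g summable_on UNIV"
    using summable_v by (simp add: square_summable_def)
  have "\<exists>T. finite T \<and> infsum ?g (- T) \<le> 1 / 4 ^ k" for k :: nat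
  proof -
    have "((\<lambda>T. infsum ?g (- T)) \<longlongrightarrow> 0) (finite_subsets_at_top UNIV)"
      using summable_g by (rule tendsto_infsum_Compl_0) (auto simp: eventually_finite_subsets_at_top)
    then have "\<forall>\<^sub>F T in finite_subsets_at_top UNIV. infsum ?g (- T) < 1 / 4 ^ k"
      by (rule order_tendstoD) simp
    then show ?thesis
      unfolding eventually_finite_subsets_at_top by (auto intro: less_imp_le)
  qed
  then obtain T where T: "\<And>k. finite (T k)" "\<And>k. infsum ?g (- T k) \<le> 1 / 4 ^ k"
    by metis
  define S where "S k = (\<Union>l\<le>k. T l)" for k
  have "infsum ?g (- S k) \<le> 1 / 4 ^ k" for k
  proof -
    have "infsum ?g (- S k) \<le> infsum ?g (- T k)"
      by (intro infsum_mono2 summable_on_subset_banach[OF summable_g]) (auto simp: S_def)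
    then show ?thesis
      using T(2)[of k] by linarith
  qed
  moreover have "finite (S k)" "incseq S" for k
    using T(1) by (force simp: S_def incseq_def)+
  ultimately show ?thesis
    using summable_v by (intro that[of S]) (auto simp: rapidly_exhausts_def)
qed

lemma rapidly_exhausts_dominated:
  assumes exhausts: "rapidly_exhausts S v" and dominated: "\<And>\<alpha>. norm (w \<alpha>) \<le> c * norm (v \<alpha>)"
  shows "rapidly_exhausts S w"
proof -
  obtain K where tail: "\<And>k. (\<Sum>\<^sub>\<infinity>\<alpha>\<in>- S k. (norm (v \<alpha>))\<^sup>2) \<le> K / 4 ^ k"
    using exhausts by (auto simp: rapidly_exhausts_def)
  have summable_v: "square_summable v"
    using exhausts by (simp add: rapidly_exhausts_def)
  then have summable_w: "square_summable w"
    using dominated by (rule square_summable_dominated)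
  have "(\<Sum>\<^sub>\<infinity>\<alpha>\<in>- S k. (norm (w \<alpha>))\<^sup>2) \<le> (c\<^sup>2 * K) / 4 ^ k" for k
  proof -
    have "(\<Sum>\<^sub>\<infinity>\<alpha>\<in>- S k. (norm (w \<alpha>))\<^sup>2) \<le> (\<Sum>\<^sub>\<infinity>\<alpha>\<in>- S k. c\<^sup>2 * (norm (v \<alpha>))\<^sup>2)"
      using summable_v summable_w unfolding square_summable_def
      by (intro infsum_mono summable_on_cmult_right norm_sq_dominated dominated)
        (auto intro: summable_on_subset_banach)
    also have "\<dots> = c\<^sup>2 * (\<Sum>\<^sub>\<infinity>\<alpha>\<in>- S k. (norm (v \<alpha>))\<^sup>2)"
      by (rule infsum_cmult_right')
    also have "\<dots> \<le> c\<^sup>2 * (K / 4 ^ k)"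
      by (intro mult_left_mono tail) simp
    finally show ?thesis
      by simp
  qed
  then show ?thesis
    using exhausts summable_w by (auto simp: rapidly_exhausts_def)
qed

lemma rapidly_exhausts_support:
  assumes "rapidly_exhausts S v" "v \<alpha> \<noteq> 0"
  shows "\<forall>\<^sub>F k in sequentially. \<alpha> \<in> S k"
proof -
  obtain K where tail: "\<And>k. (\<Sum>\<^sub>\<infinity>\<alpha>\<in>- S k. (norm (v \<alpha>))\<^sup>2) \<le> K / 4 ^ k"
    using assms(1) by (auto simp: rapidly_exhausts_def)
  have "(\<lambda>k. K * (1 / 4) ^ k) \<longlonglongrightarrow> K * 0"
    by (intro tendsto_mult_left LIMSEQ_power_zero) simp
  then have "\<forall>\<^sub>F k in sequentially. K / 4 ^ k < (norm (v \<alpha>))\<^sup>2"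
    using assms(2) by (intro order_tendstoD(2)[where y = 0]) (simp_all add: power_divide)
  then show ?thesis
  proof eventually_elim
    case (elim k)
    show ?case
    proof (rule ccontr)
      assume "\<alpha> \<notin> S k"
      then have "(norm (v \<alpha>))\<^sup>2 \<le> (\<Sum>\<^sub>\<infinity>\<alpha>\<in>- S k. (norm (v \<alpha>))\<^sup>2)"
        using assms(1) finite_sum_le_infsum[of "\<lambda>\<alpha>. (norm (v \<alpha>))\<^sup>2" "- S k" "{\<alpha>}"]
        by (auto simp: rapidly_exhausts_def square_summable_def intro: summable_on_subset_banach)
      then show False
        using tail[of k] elim by linarith
    qed
  qed
qed

subsection \<open>Random series over an orthonormal system\<close>

text \<open>The values may lie in a non-separable space, where sums and limits of Borel functions need not
  be Borel; the finite sums are nevertheless limits of simple functions.\<close>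

lemma borel_measurable_sum_scaleR_const:
  fixes v :: "'i \<Rightarrow> 'v :: real_normed_vector"
  assumes "\<And>\<alpha>. \<xi> \<alpha> \<in> borel_measurable M"
  shows "(\<lambda>\<omega>. \<Sum>\<alpha>\<in>F. \<xi> \<alpha> \<omega> *\<^sub>R v \<alpha>) \<in> borel_measurable M"
proof -
  have "\<exists>s. (\<forall>i. simple_function M (s i)) \<and> (\<forall>\<omega>\<in>space M. (\<lambda>i. s i \<omega>) \<longlonglongrightarrow> \<xi> \<alpha> \<omega>)" for \<alpha>
    using borel_measurable_implies_sequence_metric[OF assms[of \<alpha>], of 0] by blast
  then obtain s where s: "\<And>\<alpha> i. simple_function M (s \<alpha> i)"
      "\<And>\<alpha> \<omega>. \<omega> \<in> space M \<Longrightarrow> (\<lambda>i. s \<alpha> i \<omega>) \<longlonglongrightarrow> \<xi> \<alpha> \<omega>"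
    by metis
  show ?thesis
  proof (rule borel_measurable_LIMSEQ_metric)
    show "(\<lambda>\<omega>. \<Sum>\<alpha>\<in>F. s \<alpha> i \<omega> *\<^sub>R v \<alpha>) \<in> borel_measurable M" for i
      by (intro borel_measurable_simple_function simple_function_sum
          simple_function_compose1[OF s(1), where g = "\<lambda>x. x *\<^sub>R v _"])
    show "(\<lambda>i. \<Sum>\<alpha>\<in>F. s \<alpha> i \<omega> *\<^sub>R v \<alpha>) \<longlonglongrightarrow> (\<Sum>\<alpha>\<in>F. \<xi> \<alpha> \<omega> *\<^sub>R v \<alpha>)" if "\<omega> \<in> space M" for \<omega>
      by (intro tendsto_intros s that)
  qed
qed

lemma Cauchy_if_summable_dist:
  fixes s :: "nat \<Rightarrow> 'b :: metric_space"
  assumes "summable (\<lambda>n. dist (s n) (s (Suc n)))"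
  shows "Cauchy s"
proof (rule CauchyI')
  let ?t = "\<lambda>n. \<Sum>k<n. dist (s k) (s (Suc k))"
  fix \<epsilon> :: real assume "\<epsilon> > 0"
  have "Cauchy ?t"
    using assms by (intro convergent_Cauchy) (simp add: summable_iff_convergent)
  then obtain N where N: "\<And>m n. m \<ge> N \<Longrightarrow> n \<ge> N \<Longrightarrow> dist (?t m) (?t n) < \<epsilon>"
    using metric_CauchyD[OF _ \<open>\<epsilon> > 0\<close>] by blast
  have dist_le: "dist (s m) (s n) \<le> ?t n - ?t m" if "m \<le> n" for m n
    using that
  proof (induction n rule: dec_induct)
    case (step n)
    then show ?case
      using dist_triangle[of "s m" "s (Suc n)" "s n"] by simp
  qed simp
  have "dist (s m) (s n) < \<epsilon>" if "m \<ge> N" "n > m" for m n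
    using dist_le[of m n] N[of m n] that by (simp add: dist_real_def)
  then show "\<exists>M. \<forall>m\<ge>M. \<forall>n>m. dist (s m) (s n) < \<epsilon>"
    by blast
qed

lemma ex_AE_limit_if_summable_dist:
  fixes X :: "nat \<Rightarrow> 'a \<Rightarrow> 'b :: complete_space"
  assumes X: "\<And>k. X k \<in> borel_measurable M"
    and dist [measurable]: "\<And>k. (\<lambda>\<omega>. dist (X k \<omega>) (X (Suc k) \<omega>)) \<in> borel_measurable M"
    and summable: "suminf (\<lambda>k. \<integral>\<^sup>+\<omega>. ennreal (dist (X k \<omega>) (X (Suc k) \<omega>)) \<partial>M) \<noteq> \<infinity>"
  obtains Y where "Y \<in> borel_measurable M" "AE \<omega> in M. (\<lambda>k. X k \<omega>) \<longlonglongrightarrow> Y \<omega>"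
proof -
  define g where "g \<omega> = suminf (\<lambda>k. ennreal (dist (X k \<omega>) (X (Suc k) \<omega>)))" for \<omega>
  define Y where "Y \<omega> = (if g \<omega> \<noteq> \<infinity> then lim (\<lambda>k. X k \<omega>) else undefined)" for \<omega>
  have [measurable]: "g \<in> borel_measurable M"
    unfolding g_def by measurable
  have "(\<integral>\<^sup>+\<omega>. g \<omega> \<partial>M) \<noteq> \<infinity>"
    using summable unfolding g_def by (subst nn_integral_suminf) auto
  then have finite: "AE \<omega> in M. g \<omega> \<noteq> \<infinity>"
    by (intro nn_integral_PInf_AE) auto
  have Y: "(\<lambda>k. X k \<omega>) \<longlonglongrightarrow> Y \<omega>" if "g \<omega> \<noteq> \<infinity>" for \<omega>
  proof -
    have "summable (\<lambda>k. dist (X k \<omega>) (X (Suc k) \<omega>))"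
      using that unfolding g_def by (intro summable_suminf_not_top) auto
    then have "convergent (\<lambda>k. X k \<omega>)"
      by (intro Cauchy_convergent Cauchy_if_summable_dist)
    then show ?thesis
      using that by (simp add: Y_def convergent_LIMSEQ_iff)
  qed
  have "Y \<in> borel_measurable M"
  proof (rule borel_measurable_LIMSEQ_metric)
    show "(\<lambda>\<omega>. if g \<omega> \<noteq> \<infinity> then X k \<omega> else undefined) \<in> borel_measurable M" for k
      using X by measurable
    show "(\<lambda>k. if g \<omega> \<noteq> \<infinity> then X k \<omega> else undefined) \<longlonglongrightarrow> Y \<omega>" for \<omega>
      using Y[of \<omega>] by (auto simp: Y_def)
  qed
  moreover have "AE \<omega> in M. (\<lambda>k. X k \<omega>) \<longlonglongrightarrow> Y \<omega>"
    using finite by eventually_elim (rule Y)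
  ultimately show ?thesis
    by (rule that)
qed

locale orthonormal_system = prob_space M for M :: "'a measure" +
  fixes \<xi> :: "'i \<Rightarrow> 'a \<Rightarrow> real"
  assumes \<xi>_measurable [measurable]: "\<xi> \<alpha> \<in> borel_measurable M"
    and \<xi>_integrable: "integrable M (\<lambda>\<omega>. \<xi> \<alpha> \<omega> * \<xi> \<beta> \<omega>)"
    and \<xi>_orthonormal: "expectation (\<lambda>\<omega>. \<xi> \<alpha> \<omega> * \<xi> \<beta> \<omega>) = (if \<alpha> = \<beta> then 1 else 0)"
begin

definition partial_sum :: "('i \<Rightarrow> 'v :: real_normed_vector) \<Rightarrow> 'i set \<Rightarrow> 'a \<Rightarrow> 'v" where
  "partial_sum v F \<omega> = (\<Sum>\<alpha>\<in>F. \<xi> \<alpha> \<omega> *\<^sub>R v \<alpha>)"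

lemma partial_sum_measurable [measurable]: "partial_sum v F \<in> borel_measurable M"
  unfolding partial_sum_def[abs_def] by (rule borel_measurable_sum_scaleR_const) simp

lemma nn_integral_norm_partial_sum_sq:
  fixes v :: "'i \<Rightarrow> 'v :: real_inner"
  assumes "finite F"
  shows "(\<integral>\<^sup>+\<omega>. ennreal ((norm (partial_sum v F \<omega>))\<^sup>2) \<partial>M) = ennreal (\<Sum>\<alpha>\<in>F. (norm (v \<alpha>))\<^sup>2)"
proof -
  have eq: "(norm (partial_sum v F \<omega>))\<^sup>2 = (\<Sum>\<alpha>\<in>F. \<Sum>\<beta>\<in>F. (v \<alpha> \<bullet> v \<beta>) * (\<xi> \<alpha> \<omega> * \<xi> \<beta> \<omega>))" for \<omega>
    by (simp add: partial_sum_def power2_norm_eq_inner inner_sum_left inner_sum_right sum_distrib_left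
        inner_commute mult_ac)
  have "integrable M (\<lambda>\<omega>. (norm (partial_sum v F \<omega>))\<^sup>2)"
    unfolding eq by (intro Bochner_Integration.integrable_sum integrable_mult_right \<xi>_integrable)
  then have "(\<integral>\<^sup>+\<omega>. ennreal ((norm (partial_sum v F \<omega>))\<^sup>2) \<partial>M)
      = ennreal (expectation (\<lambda>\<omega>. (norm (partial_sum v F \<omega>))\<^sup>2))"
    by (intro nn_integral_eq_integral) auto
  also have "expectation (\<lambda>\<omega>. (norm (partial_sum v F \<omega>))\<^sup>2)
      = (\<Sum>\<alpha>\<in>F. \<Sum>\<beta>\<in>F. (v \<alpha> \<bullet> v \<beta>) * expectation (\<lambda>\<omega>. \<xi> \<alpha> \<omega> * \<xi> \<beta> \<omega>))"
    unfolding eq by (simp add: Bochner_Integration.integral_sum \<xi>_integrable)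
  also have "\<dots> = (\<Sum>\<alpha>\<in>F. (norm (v \<alpha>))\<^sup>2)"
    using assms by (simp add: \<xi>_orthonormal power2_norm_eq_inner if_distrib sum.delta cong: if_cong)
  finally show ?thesis .
qed

text \<open>All limits are taken almost surely along one sequence of index sets: differences of Borel maps
  into a non-separable space need not be Borel, so \<open>L\<^sub>2\<close> limits cannot be combined by the triangle
  inequality.\<close>

definition converges_along ::
    "(nat \<Rightarrow> 'i set) \<Rightarrow> ('i \<Rightarrow> 'v :: real_normed_vector) \<Rightarrow> ('a \<Rightarrow> 'v) \<Rightarrow> bool" where
  "converges_along S v X \<longleftrightarrow> (AE \<omega> in M. (\<lambda>k. partial_sum v (S k) \<omega>) \<longlonglongrightarrow> X \<omega>)"

lemma converges_along_diff:
  assumes "converges_along S v X" "converges_along S w Y"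
  shows "converges_along S (\<lambda>\<alpha>. v \<alpha> - w \<alpha>) (\<lambda>\<omega>. X \<omega> - Y \<omega>)"
  using assms unfolding converges_along_def partial_sum_def
  by eventually_elim (simp add: scaleR_diff_right sum_subtractf tendsto_diff)

lemma converges_along_scaleR:
  assumes "converges_along S v X"
  shows "converges_along S (\<lambda>\<alpha>. c *\<^sub>R v \<alpha>) (\<lambda>\<omega>. c *\<^sub>R X \<omega>)"
proof -
  have "partial_sum (\<lambda>\<alpha>. c *\<^sub>R v \<alpha>) F \<omega> = c *\<^sub>R partial_sum v F \<omega>" for F \<omega>
    by (simp add: partial_sum_def scaleR_sum_right mult.commute)
  then show ?thesis
    using assms by (auto simp: converges_along_def elim!: eventually_mono intro!: tendsto_intros)
qed

lemma converges_along_sum: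
  assumes "finite I" "\<And>i. i \<in> I \<Longrightarrow> converges_along S (v i) (X i)"
  shows "converges_along S (\<lambda>\<alpha>. \<Sum>i\<in>I. v i \<alpha>) (\<lambda>\<omega>. \<Sum>i\<in>I. X i \<omega>)"
proof -
  have "AE \<omega> in M. \<forall>i\<in>I. (\<lambda>k. partial_sum (v i) (S k) \<omega>) \<longlonglongrightarrow> X i \<omega>"
    using assms by (simp add: AE_finite_all converges_along_def)
  then show ?thesis
    unfolding converges_along_def
  proof eventually_elim
    case (elim \<omega>)
    have "partial_sum (\<lambda>\<alpha>. \<Sum>i\<in>I. v i \<alpha>) (S k) \<omega> = (\<Sum>i\<in>I. partial_sum (v i) (S k) \<omega>)" for k
      unfolding partial_sum_def scaleR_sum_right by (rule sum.swap)
    then show ?case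
      using elim by (simp add: tendsto_sum)
  qed
qed

lemma converges_along_truncation_finite:
  assumes exhausts: "rapidly_exhausts S v" and finite_F: "finite F"
  shows "converges_along S (truncation F v) (partial_sum v F)"
proof -
  have "\<forall>\<^sub>F k in sequentially. \<forall>\<alpha>\<in>F. v \<alpha> \<noteq> 0 \<longrightarrow> \<alpha> \<in> S k"
    using finite_F rapidly_exhausts_support[OF exhausts]
    by (auto simp: eventually_ball_finite_distrib eventually_conj_iff intro!: eventually_ball_finite)
  then have "\<forall>\<^sub>F k in sequentially. partial_sum (truncation F v) (S k) \<omega> = partial_sum v F \<omega>" for \<omega>
  proof eventually_elim
    case (elim k)
    have "finite (S k)"
      using exhausts by (simp add: rapidly_exhausts_def)
    with finite_F elim show ?case
      unfolding partial_sum_def truncation_def by (intro sum.mono_neutral_cong) auto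
  qed
  then show ?thesis
    unfolding converges_along_def by (intro AE_I2 tendsto_eventually)
qed

lemma nn_integral_norm_limit_sq_le:
  fixes v :: "'i \<Rightarrow> 'v :: real_inner"
  assumes finite_S: "\<And>k. finite (S k)" and limit_X: "converges_along S v X" and summable_v: "square_summable v"
  shows "(\<integral>\<^sup>+\<omega>. ennreal ((norm (X \<omega>))\<^sup>2) \<partial>M) \<le> ennreal (\<Sum>\<^sub>\<infinity>\<alpha>. (norm (v \<alpha>))\<^sup>2)"
proof -
  let ?g = "\<lambda>k \<omega>. ennreal ((norm (partial_sum v (S k) \<omega>))\<^sup>2)"
  have "AE \<omega> in M. ennreal ((norm (X \<omega>))\<^sup>2) \<le> liminf (\<lambda>k. ?g k \<omega>)"
    using limit_X unfolding converges_along_def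
  proof eventually_elim
    case (elim \<omega>)
    then have "(\<lambda>k. ?g k \<omega>) \<longlonglongrightarrow> ennreal ((norm (X \<omega>))\<^sup>2)"
      by (intro tendsto_ennrealI tendsto_intros)
    then show ?case
      by (subst lim_imp_Liminf) auto
  qed
  then have "(\<integral>\<^sup>+\<omega>. ennreal ((norm (X \<omega>))\<^sup>2) \<partial>M) \<le> (\<integral>\<^sup>+\<omega>. liminf (\<lambda>k. ?g k \<omega>) \<partial>M)"
    by (rule nn_integral_mono_AE)
  also have "\<dots> \<le> liminf (\<lambda>k. \<integral>\<^sup>+\<omega>. ?g k \<omega> \<partial>M)"
    by (rule nn_integral_liminf) measurable
  also have "\<dots> \<le> ennreal (\<Sum>\<^sub>\<infinity>\<alpha>. (norm (v \<alpha>))\<^sup>2)"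
    using finite_S summable_v unfolding square_summable_def
    by (intro Liminf_le) (auto simp: nn_integral_norm_partial_sum_sq
        intro!: ennreal_leI always_eventually finite_sum_le_infsum)
  finally show ?thesis .
qed

lemma L2_tendsto_truncation:
  fixes v :: "'i \<Rightarrow> 'v :: real_inner"
  assumes finite_S: "\<And>k. finite (S k)" and summable_v: "square_summable v" and limit_X: "converges_along S v X"
    and limit_Z: "\<forall>\<^sub>F i in F. converges_along S (truncation (A i) v) (Z i)"
    and eventually_A: "\<And>\<alpha>. \<forall>\<^sub>F i in F. \<alpha> \<in> A i"
  shows "L2_tendsto M Z X F"
  unfolding L2_tendsto_def
proof (rule tendsto_sandwich[where f = "\<lambda>_. 0"])
  let ?tail = "\<lambda>i. \<Sum>\<^sub>\<infinity>\<alpha>\<in>- A i. (norm (v \<alpha>))\<^sup>2"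
  have "(?tail \<longlongrightarrow> 0) F"
    using summable_v eventually_A by (intro tendsto_infsum_Compl_0) (simp_all add: square_summable_def)
  then show "((\<lambda>i. ennreal (?tail i)) \<longlongrightarrow> 0) F"
    by (auto dest: tendsto_ennrealI)
  have "(\<integral>\<^sup>+\<omega>. ennreal ((norm (Z i \<omega> - X \<omega>))\<^sup>2) \<partial>M) \<le> ennreal (?tail i)"
    if "converges_along S (truncation (A i) v) (Z i)" for i
  proof -
    have "(\<lambda>\<alpha>. v \<alpha> - truncation (A i) v \<alpha>) = truncation (- A i) v"
      by (auto simp: truncation_def)
    then have "converges_along S (truncation (- A i) v) (\<lambda>\<omega>. X \<omega> - Z i \<omega>)"
      using converges_along_diff[OF limit_X that] by simp
    then have "(\<integral>\<^sup>+\<omega>. ennreal ((norm (X \<omega> - Z i \<omega>))\<^sup>2) \<partial>M) \<le> ennreal (?tail i)"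
      using nn_integral_norm_limit_sq_le[OF finite_S _ square_summable_truncation[OF summable_v]]
      by (simp add: infsum_norm_truncation_sq)
    then show ?thesis
      by (simp add: norm_minus_commute)
  qed
  with limit_Z show "\<forall>\<^sub>F i in F. (\<integral>\<^sup>+\<omega>. ennreal ((norm (Z i \<omega> - X \<omega>))\<^sup>2) \<partial>M) \<le> ennreal (?tail i)"
    by (rule eventually_mono)
qed simp_all

lemma L2_tendsto_partial_sum:
  fixes v :: "'i \<Rightarrow> 'v :: real_inner"
  assumes exhausts: "rapidly_exhausts S v" and limit_X: "converges_along S v X"
  shows "L2_tendsto M (partial_sum v) X (finite_subsets_at_top UNIV)"
proof (rule L2_tendsto_truncation[OF _ _ limit_X])
  show "\<forall>\<^sub>F F in finite_subsets_at_top UNIV. converges_along S (truncation F v) (partial_sum v F)"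
    by (intro eventually_finite_subsets_at_top_weakI converges_along_truncation_finite[OF exhausts])
  show "\<forall>\<^sub>F F in finite_subsets_at_top UNIV. \<alpha> \<in> F" for \<alpha>
    by (auto simp: eventually_finite_subsets_at_top intro!: exI[of _ "{\<alpha>}"])
qed (use exhausts in \<open>simp_all add: rapidly_exhausts_def\<close>)

lemma nn_integral_norm_partial_sum_le:
  fixes v :: "'i \<Rightarrow> 'v :: real_inner"
  assumes "finite F" "\<epsilon> > 0"
  shows "(\<integral>\<^sup>+\<omega>. ennreal (norm (partial_sum v F \<omega>)) \<partial>M) \<le> ennreal (\<epsilon> + (\<Sum>\<alpha>\<in>F. (norm (v \<alpha>))\<^sup>2) / \<epsilon>)"
proof -
  have "x \<le> \<epsilon> + x\<^sup>2 / \<epsilon>" if "x \<ge> 0" for x :: real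
  proof (cases "x \<le> \<epsilon>")
    case True
    then show ?thesis
      using \<open>\<epsilon> > 0\<close> by (simp add: add_increasing2)
  next
    case False
    then have "x * \<epsilon> \<le> x\<^sup>2"
      using that by (simp add: power2_eq_square mult_left_mono)
    then show ?thesis
      using \<open>\<epsilon> > 0\<close> by (simp add: field_simps add_increasing)
  qed
  then have "(\<integral>\<^sup>+\<omega>. ennreal (norm (partial_sum v F \<omega>)) \<partial>M)
      \<le> (\<integral>\<^sup>+\<omega>. ennreal \<epsilon> + ennreal (1 / \<epsilon>) * ennreal ((norm (partial_sum v F \<omega>))\<^sup>2) \<partial>M)"
    using \<open>\<epsilon> > 0\<close>
    by (intro nn_integral_mono) (simp flip: ennreal_plus ennreal_mult')
  also have "\<dots> = ennreal \<epsilon> + ennreal (1 / \<epsilon>) * ennreal (\<Sum>\<alpha>\<in>F. (norm (v \<alpha>))\<^sup>2)"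
    using \<open>finite F\<close>
    by (simp add: nn_integral_add nn_integral_cmult nn_integral_norm_partial_sum_sq emeasure_space_1)
  also have "\<dots> = ennreal (\<epsilon> + (\<Sum>\<alpha>\<in>F. (norm (v \<alpha>))\<^sup>2) / \<epsilon>)"
    using \<open>\<epsilon> > 0\<close> by (simp add: sum_nonneg flip: ennreal_plus ennreal_mult')
  finally show ?thesis .
qed

lemma ex_converges_along:
  fixes v :: "'i \<Rightarrow> 'v :: {real_inner, complete_space}"
  assumes exhausts: "rapidly_exhausts S v"
  obtains X where "X \<in> borel_measurable M" "converges_along S v X"
proof -
  let ?D = "\<lambda>k. S (Suc k) - S k"
  obtain K where tail: "\<And>k. (\<Sum>\<^sub>\<infinity>\<alpha>\<in>- S k. (norm (v \<alpha>))\<^sup>2) \<le> K / 4 ^ k"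
    and sets_S: "\<And>k. finite (S k)" "incseq S" and summable_v: "(\<lambda>\<alpha>. (norm (v \<alpha>))\<^sup>2) summable_on UNIV"
    using exhausts by (auto simp: rapidly_exhausts_def square_summable_def)
  have dist: "dist (partial_sum v (S k) \<omega>) (partial_sum v (S (Suc k)) \<omega>)
      = norm (partial_sum v (?D k) \<omega>)" for k \<omega>
    unfolding partial_sum_def dist_commute[of "sum _ (S k)"] dist_norm
    using sets_S by (subst sum_diff) (auto simp: incseq_SucD norm_minus_commute)
  have "(\<integral>\<^sup>+\<omega>. ennreal (norm (partial_sum v (?D k) \<omega>)) \<partial>M) \<le> ennreal ((1 + K) * (1 / 2) ^ k)" for k
  proof -
    have "(\<Sum>\<alpha>\<in>?D k. (norm (v \<alpha>))\<^sup>2) \<le> (\<Sum>\<^sub>\<infinity>\<alpha>\<in>- S k. (norm (v \<alpha>))\<^sup>2)"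
      using sets_S by (intro finite_sum_le_infsum summable_on_subset_banach[OF summable_v]) auto
    then have "(1 / 2) ^ k + (\<Sum>\<alpha>\<in>?D k. (norm (v \<alpha>))\<^sup>2) / (1 / 2) ^ k \<le> (1 / 2) ^ k + (K / 4 ^ k) / (1 / 2) ^ k"
      using tail[of k] by (intro add_left_mono divide_right_mono) auto
    also have "\<dots> = (1 + K) * (1 / 2) ^ k"
      using power_mult_distrib[of "2::real" 2 k] by (simp add: power_divide field_simps)
    finally show ?thesis
      using nn_integral_norm_partial_sum_le[of "?D k" "(1 / 2) ^ k" v] sets_S
      by (auto intro: order_trans ennreal_leI)
  qed
  then have "suminf (\<lambda>k. \<integral>\<^sup>+\<omega>. ennreal (norm (partial_sum v (?D k) \<omega>)) \<partial>M)
      \<le> suminf (\<lambda>k. ennreal ((1 + K) * (1 / 2) ^ k))"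
    by (intro suminf_le) auto
  also have "\<dots> < \<infinity>"
  proof -
    have "K \<ge> 0"
      using tail[of 0] infsum_nonneg[of "- S 0" "\<lambda>\<alpha>. (norm (v \<alpha>))\<^sup>2"] by simp
    then have "suminf (\<lambda>k. ennreal ((1 + K) * (1 / 2) ^ k)) \<noteq> top"
      by (intro ennreal_suminf_neq_top summable_mult summable_geometric) auto
    then show ?thesis
      by (simp add: less_top)
  qed
  finally have "suminf (\<lambda>k. \<integral>\<^sup>+\<omega>. ennreal (dist (partial_sum v (S k) \<omega>) (partial_sum v (S (Suc k)) \<omega>)) \<partial>M) \<noteq> \<infinity>"
    unfolding dist by simp
  then show ?thesis
    by (rule ex_AE_limit_if_summable_dist[rotated 2]) (auto simp: dist converges_along_def intro: that)
qed

end

subsection \<open>The Wiener chaos basis\<close>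

definition normalized_hermite_poly :: "nat \<Rightarrow> real poly" where
  "normalized_hermite_poly n = smult (1 / sqrt (fact n)) (hermite_poly n)"

lemma gauss_expectation_normalized_hermite_poly:
  "gauss_expectation (normalized_hermite_poly m * normalized_hermite_poly n) = (if m = n then 1 else 0)"
  by (simp add: normalized_hermite_poly_def gauss_expectation_smult gauss_expectation_hermite_poly_orthogonal)

lemma chaos_basis_eq_prod:
  assumes "finite T" "Poly_Mapping.keys \<alpha> \<subseteq> T"
  shows "chaos_basis W e \<alpha> \<omega>
    = (\<Prod>k\<in>T. poly (normalized_hermite_poly (Poly_Mapping.lookup \<alpha> k)) (W (e k) \<omega>))"
proof -
  have "chaos_basis W e \<alpha> \<omega>
      = (\<Prod>k\<in>Poly_Mapping.keys \<alpha>. poly (normalized_hermite_poly (Poly_Mapping.lookup \<alpha> k)) (W (e k) \<omega>))"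
    by (simp add: chaos_basis_def hermite_eq_poly normalized_hermite_poly_def)
  also have "\<dots> = (\<Prod>k\<in>T. poly (normalized_hermite_poly (Poly_Mapping.lookup \<alpha> k)) (W (e k) \<omega>))"
    by (rule prod_keys_superset[OF assms, where g = "\<lambda>k n. poly (normalized_hermite_poly n) (W (e k) \<omega>)"])
      (simp add: normalized_hermite_poly_def)
  finally show ?thesis .
qed

context wiener_chaos
begin

lemma inj_basis: "inj e"
  by (rule injI) (metis basis_orthonormal zero_neq_one)

sublocale gaussian: orthonormal_gaussian_sequence P "\<lambda>k. W (e k)"
proof
  fix S :: "nat set" and c :: "nat \<Rightarrow> real" assume "finite S"
  then have "centered_gaussian P (\<lambda>\<omega>. \<Sum>h\<in>e ` S. c (inv e h) * W h \<omega>)"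
    using noise_gaussian by (simp add: centered_gaussian_family_def)
  then show "centered_gaussian P (\<lambda>\<omega>. \<Sum>k\<in>S. c k * W (e k) \<omega>)"
    using inj_basis by (simp add: sum.reindex inj_on_subset[OF inj_basis])
next
  show "expectation (\<lambda>\<omega>. W (e j) \<omega> * W (e k) \<omega>) = (if j = k then 1 else 0)" for j k
    by (simp add: noise_covariance basis_orthonormal)
qed

lemma has_moments_chaos_basis: "has_moments (chaos_basis W e \<alpha>)"
proof -
  have "chaos_basis W e \<alpha>
      = (\<lambda>\<omega>. \<Prod>k\<in>Poly_Mapping.keys \<alpha>. poly (normalized_hermite_poly (Poly_Mapping.lookup \<alpha> k)) (W (e k) \<omega>))"
    by (intro ext chaos_basis_eq_prod) auto
  then show ?thesis
    by (auto intro!: has_moments_prod has_moments_poly gaussian.has_moments_component)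
qed

lemma chaos_basis_orthonormal:
  "expectation (\<lambda>\<omega>. chaos_basis W e \<alpha> \<omega> * chaos_basis W e \<beta> \<omega>) = (if \<alpha> = \<beta> then 1 else 0)"
proof -
  define T where "T = Poly_Mapping.keys \<alpha> \<union> Poly_Mapping.keys \<beta>"
  have T: "finite T" "Poly_Mapping.keys \<alpha> \<subseteq> T" "Poly_Mapping.keys \<beta> \<subseteq> T"
    by (auto simp: T_def)
  let ?p = "\<lambda>\<gamma> k. normalized_hermite_poly (Poly_Mapping.lookup \<gamma> k)"
  have "expectation (\<lambda>\<omega>. chaos_basis W e \<alpha> \<omega> * chaos_basis W e \<beta> \<omega>)
      = expectation (\<lambda>\<omega>. \<Prod>k\<in>T. poly (?p \<alpha> k * ?p \<beta> k) (W (e k) \<omega>))"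
    by (simp only: chaos_basis_eq_prod[OF T(1,2)] chaos_basis_eq_prod[OF T(1,3)] poly_mult prod.distrib)
  also have "\<dots> = (\<Prod>k\<in>T. if Poly_Mapping.lookup \<alpha> k = Poly_Mapping.lookup \<beta> k then 1 else 0)"
    by (simp only: gaussian.expectation_prod_poly[OF T(1)] gauss_expectation_normalized_hermite_poly)
  also have "\<dots> = (if \<alpha> = \<beta> then 1 else 0)"
  proof (cases "\<alpha> = \<beta>")
    case False
    then obtain k where "Poly_Mapping.lookup \<alpha> k \<noteq> Poly_Mapping.lookup \<beta> k"
      using poly_mapping_eqI[of \<alpha> \<beta>] by blast
    moreover from this have "k \<in> T"
      by (auto simp: T_def in_keys_iff)
    ultimately show ?thesis
      using T(1) False by (auto intro!: prod_zero)
  qed simp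
  finally show ?thesis .
qed

sublocale chaos: orthonormal_system P "chaos_basis W e"
proof
  show "chaos_basis W e \<alpha> \<in> borel_measurable P" for \<alpha>
    by (rule has_moments_measurable[OF has_moments_chaos_basis])
  show "integrable P (\<lambda>\<omega>. chaos_basis W e \<alpha> \<omega> * chaos_basis W e \<beta> \<omega>)" for \<alpha> \<beta>
    by (intro has_moments_integrable has_moments_mult has_moments_chaos_basis)
qed (rule chaos_basis_orthonormal)

lemma has_chaos_expansion_if_converges_along:
  fixes v :: "'v :: real_inner chaos_series"
  assumes "rapidly_exhausts S v" "X \<in> borel_measurable P" "chaos.converges_along S v X"
  shows "has_chaos_expansion P W e X v"
  using chaos.L2_tendsto_partial_sum[OF assms(1,3)] assms(2)
  by (simp add: has_chaos_expansion_def chaos.partial_sum_def[abs_def])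

lemma converges_along_homogeneous_part_0:
  fixes w :: "'v :: real_normed_vector chaos_series"
  assumes "rapidly_exhausts S (homogeneous_part 0 w)"
  shows "chaos.converges_along S (homogeneous_part 0 w) (\<lambda>_. w 0)"
proof -
  have "chaos.partial_sum (homogeneous_part 0 w) {0} = (\<lambda>_. w 0)"
    by (simp add: fun_eq_iff chaos.partial_sum_def truncation_def chaos_basis_def)
  moreover have "truncation {0} (homogeneous_part 0 w) = homogeneous_part 0 w"
    by (simp add: fun_eq_iff truncation_def mi_deg_eq_0_iff)
  ultimately show ?thesis
    using chaos.converges_along_truncation_finite[OF assms, of "{0}"] by simp
qed

lemma ex_homogeneous_expansion:
  fixes w :: "'v :: {real_inner, complete_space} chaos_series" and b :: "nat \<Rightarrow> real"
  defines "z \<equiv> weight_op (\<lambda>\<alpha>. b (mi_deg \<alpha>)) w"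
  assumes summable_z: "square_summable z" and b_nonzero: "\<And>n. b n \<noteq> 0"
  obtains X Y where "has_chaos_expansion P W e X z"
    and "\<And>n. has_chaos_expansion P W e (Y n) (homogeneous_part n w)"
    and "L2_tendsto P (\<lambda>N \<omega>. b 0 *\<^sub>R w 0 + (\<Sum>n=1..N. b n *\<^sub>R Y n \<omega>)) X sequentially"
proof -
  obtain S where exhausts_z: "rapidly_exhausts S z"
    using ex_rapidly_exhausts[OF summable_z] .
  obtain X where X: "X \<in> borel_measurable P" "chaos.converges_along S z X"
    using chaos.ex_converges_along[OF exhausts_z] .
  have exhausts_part: "rapidly_exhausts S (homogeneous_part n w)" for n
    by (rule rapidly_exhausts_dominated[OF exhausts_z, where c = "1 / \<bar>b n\<bar>"])
      (simp add: z_def weight_op_def truncation_def b_nonzero)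
  have "\<exists>Y \<in> borel_measurable P. chaos.converges_along S (homogeneous_part n w) Y
      \<and> (n = 0 \<longrightarrow> Y = (\<lambda>_. w 0))" for n
    using converges_along_homogeneous_part_0[OF exhausts_part] chaos.ex_converges_along[OF exhausts_part[of n]]
    by (cases n) auto
  then obtain Y where Y: "\<And>n. Y n \<in> borel_measurable P"
      "\<And>n. chaos.converges_along S (homogeneous_part n w) (Y n)" "Y 0 = (\<lambda>_. w 0)"
    by metis
  have "L2_tendsto P (\<lambda>N \<omega>. \<Sum>n\<le>N. b n *\<^sub>R Y n \<omega>) X sequentially"
  proof (rule chaos.L2_tendsto_truncation[OF _ summable_z X(2), where A = "\<lambda>N. {\<alpha>. mi_deg \<alpha> \<le> N}"])
    show "finite (S k)" for k
      using exhausts_z by (simp add: rapidly_exhausts_def)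
    have "chaos.converges_along S (truncation {\<alpha>. mi_deg \<alpha> \<le> N} z) (\<lambda>\<omega>. \<Sum>n\<le>N. b n *\<^sub>R Y n \<omega>)" for N
      unfolding z_def sum_homogeneous_parts[symmetric]
      by (intro chaos.converges_along_sum chaos.converges_along_scaleR Y) simp
    then show "\<forall>\<^sub>F N in sequentially. chaos.converges_along S (truncation {\<alpha>. mi_deg \<alpha> \<le> N} z)
        (\<lambda>\<omega>. \<Sum>n\<le>N. b n *\<^sub>R Y n \<omega>)"
      by simp
    show "\<forall>\<^sub>F N in sequentially. \<alpha> \<in> {\<alpha>. mi_deg \<alpha> \<le> N}" for \<alpha>
      by (simp add: eventually_ge_at_top)
  qed
  moreover have "(\<Sum>n\<le>N. b n *\<^sub>R Y n \<omega>) = b 0 *\<^sub>R w 0 + (\<Sum>n=1..N. b n *\<^sub>R Y n \<omega>)" for N \<omega>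
    by (simp add: atMost_atLeast0 sum.atLeast_Suc_atMost Y(3))
  ultimately show ?thesis
    using exhausts_z X exhausts_part Y by (intro that[of X Y] has_chaos_expansion_if_converges_along) auto
qed

lemma ex_skorohod_iter_expansion:
  fixes B :: "nat \<Rightarrow> 'v \<Rightarrow> 'v :: {real_inner, complete_space}"
  assumes "\<And>k. linear (B k)" "propagator B u" and in_L2: "u \<in> weighted_L2 (chaos_weight q)"
  shows "\<exists>X Y. has_chaos_expansion P W e X (weight_op (chaos_weight q) u)
    \<and> (\<forall>n. has_chaos_expansion P W e (Y n) (skorohod_iter (\<lambda>k v. q k *\<^sub>R B k v) n (nonrandom (u 0))))
    \<and> L2_tendsto P (\<lambda>N \<omega>. u 0 + (\<Sum>n=1..N. (1 / sqrt (fact n)) *\<^sub>R Y n \<omega>)) X sequentially"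
proof -
  let ?w = "weight_op (mi_power q) u" and ?b = "\<lambda>n. 1 / sqrt (fact n)"
  have "square_summable (weight_op (\<lambda>\<alpha>. ?b (mi_deg \<alpha>)) ?w)"
    using in_L2 by (simp only: weighted_L2_iff weight_op_chaos_weight)
  then obtain X Y where "has_chaos_expansion P W e X (weight_op (chaos_weight q) u)"
    "\<And>n. has_chaos_expansion P W e (Y n) (homogeneous_part n ?w)"
    "L2_tendsto P (\<lambda>N \<omega>. ?b 0 *\<^sub>R ?w 0 + (\<Sum>n=1..N. ?b n *\<^sub>R Y n \<omega>)) X sequentially"
    unfolding weight_op_chaos_weight using ex_homogeneous_expansion[of ?b ?w] by auto
  then show ?thesis
    unfolding skorohod_iter_scaled_propagator[OF assms(1,2)] by (auto simp: weight_op_def)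
qed

end

subsection \<open>The stochastic equation\<close>

theorem theorem5:
  fixes P :: "'a measure"
    and W :: "'u :: {real_inner, complete_space, second_countable_topology} \<Rightarrow> 'a \<Rightarrow> real"
    and e :: "nat \<Rightarrow> 'u"
    and i :: "'v :: {real_inner, complete_space} \<Rightarrow> 'h :: {real_inner, complete_space}"
    and j :: "'h \<Rightarrow> 'w :: {real_inner, complete_space}"
    and A :: "'v \<Rightarrow> 'w"
    and M :: "nat \<Rightarrow> 'v \<Rightarrow> 'w"
    and C\<^sub>A :: real
    and C :: "nat \<Rightarrow> real"
    and f :: 'w
    and u :: "'v chaos_series"
    and B :: "nat \<Rightarrow> 'v \<Rightarrow> 'v"
  assumes "wiener_chaos P W e"
    and "normal_triple i j"
    and "bounded_linear A"
    and "\<And>F. \<exists>!U. A U = F"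
    and "\<And>F. norm (inv A F) \<le> C\<^sub>A * norm F"
    and "\<And>k. bounded_linear (M k)"
    and "\<And>k v. norm (inv A (M k v)) \<le> C k * norm v"
    and "chaos_solution A M f u"
    and "B = (\<lambda>k v. - inv A (M k v))"
  shows "u 0 = inv A f
    \<and> (\<forall>\<alpha>. mi_deg \<alpha> \<ge> 1 \<longrightarrow>
        u \<alpha> = (1 / sqrt (real (mi_fact \<alpha>))) *\<^sub>R
          (\<Sum>\<sigma> | \<sigma> permutes {..<mi_deg \<alpha>}.
             fold (\<lambda>l. B (characteristic_set \<alpha> ! \<sigma> l)) [0..<mi_deg \<alpha>] (u 0)))
    \<and> (\<forall>q r Bbar.
        (\<forall>k. q k > 0) \<and> summable (\<lambda>k. (q k)\<^sup>2 * (C k)\<^sup>2) \<and> suminf (\<lambda>k. (q k)\<^sup>2 * (C k)\<^sup>2) < 1 \<and>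
        r = (\<lambda>\<alpha>. mi_power q \<alpha> / sqrt (fact (mi_deg \<alpha>))) \<and>
        Bbar = (\<lambda>k v. - (q k *\<^sub>R inv A (M k v))) \<longrightarrow>
        u \<in> weighted_L2 r
        \<and> (\<forall>n\<ge>1. (\<lambda>\<alpha>. if mi_deg \<alpha> = n then mi_power q \<alpha> *\<^sub>R u \<alpha> else 0)
                 = skorohod_iter Bbar n (nonrandom (inv A f)))
        \<and> (\<forall>\<alpha>. (\<lambda>n. (1 / sqrt (fact (Suc n))) *\<^sub>R
                      skorohod_iter Bbar (Suc n) (nonrandom (inv A f)) \<alpha>)
               sums (weight_op r u \<alpha> - nonrandom (inv A f) \<alpha>))
        \<and> (\<exists>X Y. has_chaos_expansion P W e X (weight_op r u)
             \<and> (\<forall>n\<ge>1. has_chaos_expansion P W e (Y n)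
                        (skorohod_iter Bbar n (nonrandom (inv A f))))
             \<and> L2_tendsto P
                 (\<lambda>N \<omega>. inv A f + (\<Sum>n=1..N. (1 / sqrt (fact n)) *\<^sub>R Y n \<omega>)) X sequentially))"
proof (intro conjI allI impI)
  interpret wiener_chaos P W e by fact
  have linear_bij_A: "linear A" "bij A"
    using assms(3,4) by (auto simp: bounded_linear.linear bij_iff)
  have linear_B: "linear (B k)" for k
    unfolding assms(9) by (intro linear_neg_inv_compose linear_bij_A bounded_linear.linear assms(6))
  note propagator_u = chaos_solution_imp_propagator(2)[OF linear_bij_A assms(8), folded assms(9)]
  show u_0: "u 0 = inv A f"
    by (rule chaos_solution_imp_propagator(1)[OF linear_bij_A assms(8)])
  show "u \<alpha> = (1 / sqrt (real (mi_fact \<alpha>))) *\<^sub>R (\<Sum>\<sigma> | \<sigma> permutes {..<mi_deg \<alpha>}.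
      fold (\<lambda>l. B (characteristic_set \<alpha> ! \<sigma> l)) [0..<mi_deg \<alpha>] (u 0))" for \<alpha>
    by (rule propagator_coefficient[OF linear_B propagator_u, unfolded symmetrized_fold_def])
  fix q r Bbar
  assume weights: "(\<forall>k. q k > 0) \<and> summable (\<lambda>k. (q k)\<^sup>2 * (C k)\<^sup>2) \<and> suminf (\<lambda>k. (q k)\<^sup>2 * (C k)\<^sup>2) < 1 \<and>
    r = (\<lambda>\<alpha>. mi_power q \<alpha> / sqrt (fact (mi_deg \<alpha>))) \<and> Bbar = (\<lambda>k v. - (q k *\<^sub>R inv A (M k v)))"
  then have substitutions: "r = chaos_weight q" "Bbar = (\<lambda>k v. q k *\<^sub>R B k v)" "inv A f = u 0"
    by (simp_all add: chaos_weight_def[abs_def] assms(9) u_0)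
  let ?D = "\<lambda>n. skorohod_iter Bbar n (nonrandom (inv A f))"
  show in_L2: "u \<in> weighted_L2 r"
    unfolding substitutions using weights assms(7)
      by (intro propagator_in_weighted_L2[OF linear_B _ propagator_u]) (auto simp: assms(9))
  show "(\<lambda>\<alpha>. if mi_deg \<alpha> = n then mi_power q \<alpha> *\<^sub>R u \<alpha> else 0) = ?D n" for n
    by (simp add: substitutions skorohod_iter_scaled_propagator[OF linear_B propagator_u]
        truncation_def weight_op_def fun_eq_iff)
  show "(\<lambda>n. (1 / sqrt (fact (Suc n))) *\<^sub>R ?D (Suc n) \<alpha>) sums (weight_op r u \<alpha> - nonrandom (inv A f) \<alpha>)" for \<alpha>
    unfolding substitutions by (rule skorohod_iter_sums[OF linear_B propagator_u])
  show "\<exists>X Y. has_chaos_expansion P W e X (weight_op r u) \<and> (\<forall>n\<ge>1. has_chaos_expansion P W e (Y n) (?D n))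
      \<and> L2_tendsto P (\<lambda>N \<omega>. inv A f + (\<Sum>n=1..N. (1 / sqrt (fact n)) *\<^sub>R Y n \<omega>)) X sequentially"
    using ex_skorohod_iter_expansion[OF linear_B propagator_u in_L2[unfolded substitutions]]
    unfolding substitutions by blast
qed

end
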